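(* Let $F=F(\mu)$ and $F_1=F(\nu)$ be two natural exponential families on $\mathbb{R}^n$ with $\mu,\nu\in\mathcal{M}(\mathbb{R}^n)$, and let $g=\begin{bmatrix} A & b \\ c^T & d \end{bmatrix}\in G=GL(n+1,\mathbb{R})$. Then $F=T_g(F_1)$ if and only if there exist a non-empty open subset $U$ of $\Theta(\mu)$, a map $\lambda\mapsto\theta(\lambda)$ from $U$ to $\Theta(\nu)$, and a point $\begin{bmatrix} \lambda_0 \\ -k_0 \end{bmatrix}\in\mathbb{R}^{n+1}$ (with $\lambda_0\in\mathbb{R}^n$, $k_0\in\mathbb{R}$) such that for all $\lambda\in U$ $$\begin{bmatrix} \lambda \\ -k_{\mu}(\lambda) \end{bmatrix}=\begin{bmatrix} A^T & c \\ {b}^T & d \end{bmatrix}\begin{bmatrix} \theta(\lambda) \\ -k_{\nu}(\theta(\lambda)) \end{bmatrix}+\begin{bmatrix} \lambda_0 \\ -k_0 \end{bmatrix}.$$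
   Context: For a positive measure $\mu$ on $\mathbb{R}^n$ let $L_\mu(\theta)=\int e^{\langle\theta,x\rangle}\mu(dx)\le\infty$, $D(\mu)=\{\theta: L_\mu(\theta)<\infty\}$, $\Theta(\mu)$ the interior of $D(\mu)$, $k_\mu=\log L_\mu$. $\mathcal{M}(\mathbb{R}^n)$ is the set of positive measures $\mu$ (not necessarily finite) with $\Theta(\mu)\ne\emptyset$ and $\mu$ not concentrated on an affine hyperplane. The natural exponential family (NEF) generated by $\mu$ is $F(\mu)=\{e^{\langle\theta,x\rangle-k_\mu(\theta)}\mu(dx):\theta\in\Theta(\mu)\}$. The map $k_\mu'$ is a diffeomorphism from $\Theta(\mu)$ onto an open set $M_F$ (domain of the means); $\psi_\mu$ denotes its inverse, and the variance function of $F=F(\mu)$ is $V_F(m)=k_\mu''(\psi_\mu(m))$, $m\in M_F$. Elements $g\in G=GL(n+1,\mathbb{R})$ are written in blocks $g=\begin{bmatrix} A & b \\ c^T & d \end{bmatrix}$ with $A$ an $n\times n$ matrix, $b,c\in\mathbb{R}^n$, $d\in\mathbb{R}$. Put $h_g(m)=\frac{Am+b}{c^Tm+d}$ for $c^Tm+d\neq0$, with Jacobian matrix $h_g'(m)$ (which is invertible). For $U\subset\mathbb{R}^n$ open, $U_g=\{m\in\mathbb{R}^n: c^Tm+d>0,\ h_g(m)\in U\}$. If $V$ is a map from $U$ to the $n\times n$ positive definite matrices, then for $m\in U_g$ $$T_g(V)(m)=\frac{1}{c^Tm+d}\,(h'_g(m))^{-1}\,V(h_g(m))\,(h'_g(m)^T)^{-1}.$$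 $F=T_g(F_1)$ means that $V_F(m)=T_g(V_{F_1})(m)$ for all $m$ in some non-empty open subset of $M_F\cap (M_{F_1})_g$. *)

theory Defs
  imports "HOL-Analysis.Analysis"
begin

section \<open>Natural exponential families on \<open>\<real>\<^sup>n\<close>\<close>

definition laplace :: "(real ^ 'n) measure \<Rightarrow> real ^ 'n \<Rightarrow> ennreal" where
  "laplace \<mu> \<theta> = (\<integral>\<^sup>+ x. ennreal (exp (\<theta> \<bullet> x)) \<partial>\<mu>)"

definition laplace_dom :: "(real ^ 'n) measure \<Rightarrow> (real ^ 'n) set" where
  "laplace_dom \<mu> = {\<theta>. laplace \<mu> \<theta> < \<infinity>}"

definition Theta :: "(real ^ 'n) measure \<Rightarrow> (real ^ 'n) set" where
  "Theta \<mu> = interior (laplace_dom \<mu>)"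

text \<open>Meaningful only on \<^term>\<open>laplace_dom \<mu>\<close>, where the Laplace transform is finite.\<close>

definition cumulant :: "(real ^ 'n) measure \<Rightarrow> real ^ 'n \<Rightarrow> real" where
  "cumulant \<mu> \<theta> = ln (enn2real (laplace \<mu> \<theta>))"

text \<open>The class \<open>\<M>(\<real>\<^sup>n)\<close>. The measures need not be finite. The zero measure is excluded by the
  hyperplane condition.\<close>

definition nef_generators :: "(real ^ 'n) measure set" where
  "nef_generators = {\<mu>. sets \<mu> = sets borel \<and> Theta \<mu> \<noteq> {} \<and>
     \<not> (\<exists>a \<beta>. a \<noteq> 0 \<and> (AE x in \<mu>. a \<bullet> x = \<beta>))}"

definition nef :: "(real ^ 'n) measure \<Rightarrow> (real ^ 'n) measure set" where
  "nef \<mu> = (\<lambda>\<theta>. density \<mu> (\<lambda>x. ennreal (exp (\<theta> \<bullet> x - cumulant \<mu> \<theta>)))) ` Theta \<mu>"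

text \<open>The derivatives \<open>k'\<close> (as a gradient vector) and \<open>k''\<close> (as a Hessian matrix) of the cumulant
  function, and the inverse \<open>\<psi>\<close> of \<open>k'\<close> on its image.\<close>

definition cumulant_grad :: "(real ^ 'n) measure \<Rightarrow> real ^ 'n \<Rightarrow> real ^ 'n" where
  "cumulant_grad \<mu> \<theta> = (THE D. GDERIV (cumulant \<mu>) \<theta> :> D)"

definition cumulant_hess :: "(real ^ 'n) measure \<Rightarrow> real ^ 'n \<Rightarrow> real ^ 'n ^ 'n" where
  "cumulant_hess \<mu> \<theta> = jacobian (cumulant_grad \<mu>) (at \<theta>)"

definition mean_inv :: "(real ^ 'n) measure \<Rightarrow> real ^ 'n \<Rightarrow> real ^ 'n" where
  "mean_inv \<mu> = inv_into (Theta \<mu>) (cumulant_grad \<mu>)"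

text \<open>The domain of the means and the variance function belong to the family \<open>F\<close> rather than to a
  measure. They are computed from a generating measure of \<open>F\<close>, and the result does not depend on
  which one is taken: two generators of \<open>F\<close> differ by a factor \<open>exp (\<langle>a, x\<rangle> + \<beta>)\<close>, which only
  translates \<open>\<Theta>\<close> and adds an affine function to the translated \<open>k\<close>.\<close>

definition generator :: "(real ^ 'n) measure set \<Rightarrow> (real ^ 'n) measure" where
  "generator F = (SOME \<mu>. \<mu> \<in> nef_generators \<and> F = nef \<mu>)"

definition means_dom :: "(real ^ 'n) measure set \<Rightarrow> (real ^ 'n) set" where
  "means_dom F = cumulant_grad (generator F) ` Theta (generator F)"

definition variance_fun :: "(real ^ 'n) measure set \<Rightarrow> real ^ 'n \<Rightarrow> real ^ 'n ^ 'n" where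
  "variance_fun F m = cumulant_hess (generator F) (mean_inv (generator F) m)"


section \<open>The action of \<open>GL(n+1, \<real>)\<close>\<close>

text \<open>Coordinates of \<open>\<real>\<^sup>n\<^sup>+\<^sup>1\<close> are indexed by \<^typ>\<open>'n::finite + 1\<close>, where \<^typ>\<open>1\<close> is the one-element type:
  \<^term>\<open>block_mat A b c d\<close> is the matrix with first block row \<open>A, b\<close> and second block row
  \<open>c\<^sup>T, d\<close>, and \<^term>\<open>block_vec x t\<close> is the column vector with blocks \<open>x\<close> and \<open>t\<close>.\<close>

definition block_vec :: "real ^ 'n \<Rightarrow> real \<Rightarrow> real ^ ('n::finite + 1)" where
  "block_vec x t = (\<chi> i. case i of Inl i' \<Rightarrow> x $ i' | Inr _ \<Rightarrow> t)"

definition block_mat ::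
  "real ^ 'n ^ 'n \<Rightarrow> real ^ 'n \<Rightarrow> real ^ 'n \<Rightarrow> real \<Rightarrow> real ^ ('n::finite + 1) ^ ('n::finite + 1)" where
  "block_mat A b c d = (\<chi> i. case i of Inl i' \<Rightarrow> block_vec (A $ i') (b $ i') | Inr _ \<Rightarrow> block_vec c d)"

definition blkA :: "real ^ ('n::finite + 1) ^ ('n::finite + 1) \<Rightarrow> real ^ 'n ^ 'n" where
  "blkA g = (\<chi> i j. g $ Inl i $ Inl j)"

definition blkb :: "real ^ ('n::finite + 1) ^ ('n::finite + 1) \<Rightarrow> real ^ 'n" where
  "blkb g = (\<chi> i. g $ Inl i $ Inr 1)"

definition blkc :: "real ^ ('n::finite + 1) ^ ('n::finite + 1) \<Rightarrow> real ^ 'n" where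
  "blkc g = (\<chi> j. g $ Inr 1 $ Inl j)"

definition blkd :: "real ^ ('n::finite + 1) ^ ('n::finite + 1) \<Rightarrow> real" where
  "blkd g = g $ Inr 1 $ Inr 1"

lemma blk_block_mat [simp]:
  "blkA (block_mat A b c d) = A" "blkb (block_mat A b c d) = b"
  "blkc (block_mat A b c d) = c" "blkd (block_mat A b c d) = d"
  by (simp_all add: blkA_def blkb_def blkc_def blkd_def block_mat_def block_vec_def vec_eq_iff)

lemma block_mat_mult_vec:
  "block_mat A b c d *v block_vec x t = block_vec (A *v x + t *\<^sub>R b) (c \<bullet> x + d * t)"
proof -
  have *: "(\<Sum>i\<in>UNIV. f i) = (\<Sum>i\<in>UNIV. f (Inl i)) + f (Inr (1::1))"
    for f :: "'n::finite + 1 \<Rightarrow> real"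
  proof -
    have "sum f (UNIV <+> UNIV) = (\<Sum>i\<in>UNIV. f (Inl i)) + (\<Sum>i\<in>UNIV. f (Inr (i::1)))"
      by (subst sum.Plus) simp_all
    then show ?thesis
      unfolding UNIV_Plus_UNIV by simp
  qed
  show ?thesis
    by (auto simp: vec_eq_iff matrix_vector_mult_def * block_mat_def block_vec_def inner_vec_def
        split: sum.split)
qed

definition den :: "real ^ ('n::finite + 1) ^ ('n::finite + 1) \<Rightarrow> real ^ 'n \<Rightarrow> real" where
  "den g m = blkc g \<bullet> m + blkd g"

definition hmap :: "real ^ ('n::finite + 1) ^ ('n::finite + 1) \<Rightarrow> real ^ 'n \<Rightarrow> real ^ 'n" where
  "hmap g m = (1 / den g m) *\<^sub>R (blkA g *v m + blkb g)"

definition T_dom :: "real ^ ('n::finite + 1) ^ ('n::finite + 1) \<Rightarrow> (real ^ 'n) set \<Rightarrow> (real ^ 'n) set" where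
  "T_dom g U = {m. den g m > 0 \<and> hmap g m \<in> U}"

definition T_map :: "real ^ ('n::finite + 1) ^ ('n::finite + 1) \<Rightarrow> (real ^ 'n \<Rightarrow> real ^ 'n ^ 'n)
    \<Rightarrow> real ^ 'n \<Rightarrow> real ^ 'n ^ 'n" where
  "T_map g V m = (let J = jacobian (hmap g) (at m) in
     (1 / den g m) *\<^sub>R (matrix_inv J ** V (hmap g m) ** matrix_inv (transpose J)))"

text \<open>The relation \<open>F = T\<^sub>g(F\<^sub>1)\<close> between natural exponential families.\<close>

definition nef_eq_T ::
  "(real ^ 'n) measure set \<Rightarrow> real ^ ('n::finite + 1) ^ ('n::finite + 1) \<Rightarrow> (real ^ 'n) measure set \<Rightarrow> bool" where
  "nef_eq_T F g F1 \<longleftrightarrow> (\<exists>W. open W \<and> W \<noteq> {} \<and> W \<subseteq> means_dom F \<inter> T_dom g (means_dom F1) \<and>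
     (\<forall>m\<in>W. variance_fun F m = T_map g (variance_fun F1) m))"

end

theory Submission
  imports Defs
begin

text \<open>Write \<open>m = k\<^sub>\<mu>'(\<lambda>)\<close>, \<open>m\<^sub>1 = k\<^sub>\<nu>'(\<theta>)\<close> and \<open>\<delta>\<close> for differentials. Differentiating the block equation
  gives \<open>\<delta>\<lambda> = A\<^sup>T \<delta>\<theta> - \<langle>m\<^sub>1, \<delta>\<theta>\<rangle> c\<close> and \<open>- \<langle>m, \<delta>\<lambda>\<rangle> = \<langle>b, \<delta>\<theta>\<rangle> - d \<langle>m\<^sub>1, \<delta>\<theta>\<rangle>\<close>. Eliminating \<open>\<delta>\<lambda>\<close>
  turns these into \<open>m\<^sub>1 = h\<^sub>g(m)\<close>, and then the first one reads \<open>\<delta>\<lambda> = (\<langle>c, m\<rangle> + d) h\<^sub>g'(m)\<^sup>T \<delta>\<theta>\<close>.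
  Differentiating \<open>k\<^sub>\<nu>'(\<theta>) = h\<^sub>g(k\<^sub>\<mu>'(\<lambda>))\<close> once more yields the transformation rule of the variance
  functions; positive definiteness of both Hessians forces \<open>\<langle>c, m\<rangle> + d > 0\<close>. Conversely, for
  \<open>\<theta> = \<psi>\<^sub>\<nu>(h\<^sub>g(k\<^sub>\<mu>'(\<lambda>)))\<close> the transformation rule gives back \<open>\<delta>\<lambda> = (\<langle>c, m\<rangle> + d) h\<^sub>g'(m)\<^sup>T \<delta>\<theta>\<close>, so both
  blocks of the equation hold up to constants on a ball.\<close>

section \<open>Differentiation of exponential integrals\<close>

lemma exp_quadratic_remainder:
  fixes u :: real
  shows "\<bar>exp u - 1 - u\<bar> \<le> u\<^sup>2 * exp \<bar>u\<bar>"
proof -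
  obtain t where t: "\<bar>t\<bar> \<le> \<bar>u\<bar>" "exp u = (\<Sum>m<2. u ^ m / fact m) + exp t / fact 2 * u ^ 2"
    using Maclaurin_exp_le[of u 2] by blast
  have "\<bar>exp u - 1 - u\<bar> = exp t / 2 * u\<^sup>2"
    using t(2) by (simp add: eval_nat_numeral abs_mult)
  also have "\<dots> \<le> exp \<bar>u\<bar> * u\<^sup>2"
  proof (rule mult_right_mono)
    have "exp t \<le> exp \<bar>u\<bar>"
      using t(1) by simp
    then show "exp t / 2 \<le> exp \<bar>u\<bar>"
      using exp_gt_zero[of t] by linarith
  qed simp
  finally show ?thesis
    by (simp add: mult.commute)
qed

text \<open>The norm is at most the dimension times the largest absolute coordinate, and the
  exponential belonging to that coordinate is one of the summands. Finitely many exponentials of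
  linear forms thus dominate a radial weight.\<close>

lemma exp_norm_le_sum_Basis:
  fixes x :: "'a::euclidean_space"
  assumes "0 \<le> r"
  shows "exp (r * norm x) \<le>
    (\<Sum>b\<in>Basis. exp ((r * DIM('a)) * (b \<bullet> x)) + exp (- (r * DIM('a)) * (b \<bullet> x)))"
    (is "_ \<le> sum ?s Basis")
proof -
  define K where "K = Max ((\<lambda>b. \<bar>x \<bullet> b\<bar>) ` (Basis :: 'a set))"
  have "K \<in> (\<lambda>b. \<bar>x \<bullet> b\<bar>) ` (Basis :: 'a set)"
    unfolding K_def by (intro Max_in) auto
  then obtain b :: 'a where b: "b \<in> Basis" "K = \<bar>x \<bullet> b\<bar>"
    by blast
  have "norm x \<le> (\<Sum>b\<in>Basis. \<bar>x \<bullet> b\<bar>)"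
    by (rule norm_le_l1)
  also have "\<dots> \<le> of_nat (DIM('a)) * K"
    by (rule sum_bounded_above) (auto simp: K_def)
  finally have "r * norm x \<le> r * (DIM('a) * \<bar>b \<bullet> x\<bar>)"
    using assms b by (intro mult_left_mono) (simp_all add: inner_commute)
  then have "exp (r * norm x) \<le> ?s b"
  proof (cases "0 \<le> b \<bullet> x")
    case True
    with \<open>r * norm x \<le> _\<close> have "exp (r * norm x) \<le> exp ((r * DIM('a)) * (b \<bullet> x))"
      by (simp add: mult.assoc)
    then show ?thesis
      by (rule order_trans) simp
  next
    case False
    with \<open>r * norm x \<le> _\<close> have "exp (r * norm x) \<le> exp (- (r * DIM('a)) * (b \<bullet> x))"
      by (simp add: mult.assoc)
    then show ?thesis
      by (rule order_trans) simp
  qed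
  also have "\<dots> \<le> sum ?s Basis"
    using b by (intro member_le_sum) (auto intro: add_nonneg_nonneg)
  finally show ?thesis .
qed

lemma integrable_exp_laplace_dom:
  assumes "sets \<mu> = sets borel" and "\<theta> \<in> laplace_dom \<mu>"
  shows "integrable \<mu> (\<lambda>x. exp (\<theta> \<bullet> x))"
proof (rule integrableI_nonneg)
  show "(\<lambda>x. exp (\<theta> \<bullet> x)) \<in> borel_measurable \<mu>"
    unfolding measurable_cong_sets[OF assms(1) refl] by measurable
qed (use assms(2) in \<open>auto simp: laplace_dom_def laplace_def\<close>)

text \<open>Around an interior point the Laplace domain contains the finitely many shifts
  \<open>\<theta> \<plusminus> e b\<close> along the axes. The sum of the exponentials at these
  points is integrable and dominates the radially weighted exponential, which later absorbs
  polynomial factors.\<close>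

lemma integrable_exp_norm:
  assumes \<mu>: "sets \<mu> = sets borel" and \<theta>: "\<theta> \<in> Theta \<mu>"
  obtains r where "0 < r" "integrable \<mu> (\<lambda>x. exp (r * norm x) * exp (\<theta> \<bullet> x))"
proof -
  obtain e where e: "0 < e" "cball \<theta> e \<subseteq> laplace_dom \<mu>"
    using \<theta> unfolding Theta_def mem_interior_cball by blast
  define n :: real where "n = DIM(real ^ 'a)"
  have n: "0 < n"
    by (simp add: n_def)
  \<comment> \<open>\<open>exp_norm_le_sum_Basis\<close> multiplies the rate by the dimension; this
    division brings the shifts back to length \<open>e\<close>.\<close>
  define r where "r = e / n"
  have r: "0 < r" "r * n = e"
    using e n by (auto simp: r_def)
  have dom: "s *\<^sub>R b + \<theta> \<in> laplace_dom \<mu>" if "b \<in> Basis" "\<bar>s\<bar> = e" for b s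
    using that e by (auto simp: subset_iff dist_norm)
  have "integrable \<mu> (\<lambda>x. \<Sum>b\<in>Basis. exp ((e *\<^sub>R b + \<theta>) \<bullet> x) + exp ((- e *\<^sub>R b + \<theta>) \<bullet> x))"
    by (intro Bochner_Integration.integrable_sum Bochner_Integration.integrable_add
        integrable_exp_laplace_dom[OF \<mu>] dom) (use e in auto)
  then have "integrable \<mu> (\<lambda>x. exp (r * norm x) * exp (\<theta> \<bullet> x))"
  proof (rule Bochner_Integration.integrable_bound)
    show "(\<lambda>x. exp (r * norm x) * exp (\<theta> \<bullet> x)) \<in> borel_measurable \<mu>"
      unfolding measurable_cong_sets[OF \<mu> refl] by measurable
    show "AE x in \<mu>. norm (exp (r * norm x) * exp (\<theta> \<bullet> x)) \<le>
      norm (\<Sum>b\<in>Basis. exp ((e *\<^sub>R b + \<theta>) \<bullet> x) + exp ((- e *\<^sub>R b + \<theta>) \<bullet> x))"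
    proof (rule AE_I2)
      fix x :: "real ^ 'a"
      have "exp (r * norm x) * exp (\<theta> \<bullet> x) \<le>
        (\<Sum>b\<in>Basis. exp (e * (b \<bullet> x)) + exp (- e * (b \<bullet> x))) * exp (\<theta> \<bullet> x)"
        using exp_norm_le_sum_Basis[of r x] r by (intro mult_right_mono) (auto simp: n_def)
      also have "\<dots> = (\<Sum>b\<in>Basis. exp ((e *\<^sub>R b + \<theta>) \<bullet> x) + exp ((- e *\<^sub>R b + \<theta>) \<bullet> x))"
        by (simp add: sum_distrib_left inner_diff_left inner_add_left exp_add exp_diff exp_minus
            distrib_left divide_inverse ac_simps)
      finally show "norm (exp (r * norm x) * exp (\<theta> \<bullet> x)) \<le>
        norm (\<Sum>b\<in>Basis. exp ((e *\<^sub>R b + \<theta>) \<bullet> x) + exp ((- e *\<^sub>R b + \<theta>) \<bullet> x))"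
        by simp
    qed
  qed
  with r that show ?thesis
    by blast
qed

lemma norm_times_exp_le:
  fixes x :: "'a::real_normed_vector"
  assumes "0 < r"
  shows "norm x \<le> (1 / r) * exp (r * norm x)" "(norm x)\<^sup>2 \<le> (2 / r\<^sup>2) * exp (r * norm x)"
proof -
  have "r * norm x \<le> exp (r * norm x)"
    using exp_ge_add_one_self[of "r * norm x"] by linarith
  then show "norm x \<le> (1 / r) * exp (r * norm x)"
    using assms by (simp add: field_simps)
  have "1 + r * norm x + (r * norm x)\<^sup>2 / 2 \<le> exp (r * norm x)"
    using assms by (intro exp_lower_Taylor_quadratic) auto
  then have "(r * norm x)\<^sup>2 \<le> 2 * exp (r * norm x)"
    using mult_nonneg_nonneg[of r "norm x"] assms norm_ge_zero[of x] by linarith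
  then show "(norm x)\<^sup>2 \<le> (2 / r\<^sup>2) * exp (r * norm x)"
    using assms by (simp add: field_simps)
qed

text \<open>Domination with \<open>f\<close> kept apart from the weight: \<open>q\<close> is later
  \<open>exp (\<eta> \<bullet> x)\<close> for a nearby \<open>\<eta>\<close>, or a linear form times
  \<open>exp (\<theta> \<bullet> x)\<close>.\<close>

lemma integrable_scaleR_exp_bound:
  fixes f :: "real ^ 'n \<Rightarrow> 'b::{banach, second_countable_topology}"
  assumes "sets \<mu> = sets borel" "f \<in> borel_measurable borel" "q \<in> borel_measurable borel"
    and "integrable \<mu> (\<lambda>x. (exp (r * norm x) * exp (\<theta> \<bullet> x)) *\<^sub>R f x)"
    and "\<And>x. \<bar>q x\<bar> \<le> C * (exp (r * norm x) * exp (\<theta> \<bullet> x))"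
  shows "integrable \<mu> (\<lambda>x. q x *\<^sub>R f x)"
proof (rule Bochner_Integration.integrable_bound)
  show "integrable \<mu> (\<lambda>x. C *\<^sub>R ((exp (r * norm x) * exp (\<theta> \<bullet> x)) *\<^sub>R f x))"
    by (rule integrable_scaleR_right[OF assms(4)])
  show "(\<lambda>x. q x *\<^sub>R f x) \<in> borel_measurable \<mu>"
    using assms(2,3) unfolding measurable_cong_sets[OF assms(1) refl] by measurable
  have "\<bar>q x\<bar> * norm (f x) \<le> (\<bar>C\<bar> * (exp (r * norm x) * exp (\<theta> \<bullet> x))) * norm (f x)" for x
    by (intro mult_right_mono order_trans[OF assms(5)]) auto
  then show "AE x in \<mu>. norm (q x *\<^sub>R f x) \<le> norm (C *\<^sub>R ((exp (r * norm x) * exp (\<theta> \<bullet> x)) *\<^sub>R f x))"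
    by (auto simp: abs_mult mult.assoc)
qed

text \<open>Differentiation under the integral with an explicit error: the pointwise Taylor
  remainder is quadratic in \<open>\<eta> - \<theta>\<close> and dominated by the integrable weight.
  The factor \<open>f\<close> is 1 for the Laplace transform and \<open>x\<close> for its
  gradient.\<close>

lemma has_derivative_integral_exp:
  fixes f :: "real ^ 'n \<Rightarrow> 'b::{banach, second_countable_topology}"
  assumes \<mu>: "sets \<mu> = sets borel" and f: "f \<in> borel_measurable borel" and r: "0 < r"
    and int: "integrable \<mu> (\<lambda>x. (exp (r * norm x) * exp (\<theta> \<bullet> x)) *\<^sub>R f x)"
  shows "((\<lambda>\<eta>. \<integral>x. exp (\<eta> \<bullet> x) *\<^sub>R f x \<partial>\<mu>) has_derivative
    (\<lambda>h. \<integral>x. (h \<bullet> x) *\<^sub>R exp (\<theta> \<bullet> x) *\<^sub>R f x \<partial>\<mu>)) (at \<theta>)"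
proof -
  define w where "w x = exp (r * norm x) * exp (\<theta> \<bullet> x)" for x
  define K where "K = (\<integral>x. norm (w x *\<^sub>R f x) \<partial>\<mu>)"
  have intw: "integrable \<mu> (\<lambda>x. norm (w x *\<^sub>R f x))"
    using int unfolding w_def by (rule integrable_norm)
  note int_bound = integrable_scaleR_exp_bound[OF \<mu> f _ int]
  have lin_le: "\<bar>(h \<bullet> x) * exp (\<theta> \<bullet> x)\<bar> \<le> (norm h / r) * w x" for h x
  proof -
    have "\<bar>h \<bullet> x\<bar> \<le> norm h * norm x"
      by (rule Cauchy_Schwarz_ineq2)
    also have "\<dots> \<le> norm h * ((1 / r) * exp (r * norm x))"
      by (intro mult_left_mono norm_times_exp_le r) auto
    finally have "\<bar>h \<bullet> x\<bar> * exp (\<theta> \<bullet> x) \<le> (norm h * ((1 / r) * exp (r * norm x))) * exp (\<theta> \<bullet> x)"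
      by (rule mult_right_mono) auto
    then show ?thesis
      by (simp add: w_def abs_mult mult.assoc)
  qed
  have int_lin: "integrable \<mu> (\<lambda>x. (h \<bullet> x) *\<^sub>R exp (\<theta> \<bullet> x) *\<^sub>R f x)" for h
    unfolding scaleR_scaleR
    by (rule int_bound[OF _ lin_le[unfolded w_def]]) simp
  have int_exp: "integrable \<mu> (\<lambda>x. exp (\<eta> \<bullet> x) *\<^sub>R f x)" if "dist \<eta> \<theta> < r / 2" for \<eta>
  proof (rule int_bound)
    fix x
    have "(\<eta> - \<theta>) \<bullet> x \<le> norm (\<eta> - \<theta>) * norm x"
      by (rule norm_cauchy_schwarz)
    also have "\<dots> \<le> r * norm x"
      using that r by (intro mult_right_mono) (auto simp: dist_norm)
    finally show "\<bar>exp (\<eta> \<bullet> x)\<bar> \<le> 1 * (exp (r * norm x) * exp (\<theta> \<bullet> x))"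
      by (simp add: inner_diff_left flip: exp_add)
  qed auto
  \<comment> \<open>Within distance \<open>r / 2\<close>, one half of the radial weight bounds
    \<open>exp \<bar>u\<bar>\<close> and the other half absorbs \<open>(norm x)\<^sup>2\<close>, at
    the cost of \<open>2 / (r / 2)\<^sup>2 = 8 / r\<^sup>2\<close>.\<close>
  have rem_le: "\<bar>exp (\<eta> \<bullet> x) - exp (\<theta> \<bullet> x) - ((\<eta> - \<theta>) \<bullet> x) * exp (\<theta> \<bullet> x)\<bar>
      \<le> (norm (\<eta> - \<theta>))\<^sup>2 * (8 / r\<^sup>2) * w x" if "dist \<eta> \<theta> < r / 2" for \<eta> x
  proof -
    define u where "u = (\<eta> - \<theta>) \<bullet> x"
    have u: "\<bar>u\<bar> \<le> norm (\<eta> - \<theta>) * norm x"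
      unfolding u_def by (rule Cauchy_Schwarz_ineq2)
    also have "\<dots> \<le> r / 2 * norm x"
      using that by (intro mult_right_mono) (auto simp: dist_norm)
    finally have u': "\<bar>u\<bar> \<le> r / 2 * norm x" .
    have "\<bar>exp u - 1 - u\<bar> \<le> u\<^sup>2 * exp \<bar>u\<bar>"
      by (rule exp_quadratic_remainder)
    also have "\<dots> \<le> (norm (\<eta> - \<theta>) * norm x)\<^sup>2 * exp (r / 2 * norm x)"
      using u u' by (intro mult_mono) (auto simp: abs_le_square_iff[symmetric])
    also have "\<dots> \<le> ((norm (\<eta> - \<theta>))\<^sup>2 * ((2 / (r / 2)\<^sup>2) * exp (r / 2 * norm x))) * exp (r / 2 * norm x)"
      unfolding power_mult_distrib using r by (intro mult_right_mono mult_left_mono norm_times_exp_le) auto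
    also have "\<dots> = (norm (\<eta> - \<theta>))\<^sup>2 * (8 / r\<^sup>2) * exp (r * norm x)"
    proof -
      have "exp (r / 2 * norm x) * exp (r / 2 * norm x) = exp (r * norm x)"
        by (simp flip: exp_add)
      then show ?thesis
        by (simp add: power_divide mult.assoc)
    qed
    finally have "\<bar>exp u - 1 - u\<bar> * exp (\<theta> \<bullet> x) \<le>
      (norm (\<eta> - \<theta>))\<^sup>2 * (8 / r\<^sup>2) * exp (r * norm x) * exp (\<theta> \<bullet> x)"
      by (rule mult_right_mono) auto
    moreover have "exp (\<eta> \<bullet> x) = exp u * exp (\<theta> \<bullet> x)"
      by (simp add: u_def inner_diff_left flip: exp_add)
    then have "exp (\<eta> \<bullet> x) - exp (\<theta> \<bullet> x) - u * exp (\<theta> \<bullet> x) = (exp u - 1 - u) * exp (\<theta> \<bullet> x)"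
      by (simp add: algebra_simps)
    ultimately show ?thesis
      by (simp add: u_def[symmetric] w_def abs_mult mult.assoc)
  qed
  show ?thesis
  proof (rule has_derivativeI_sandwich)
    show "0 < r / 2"
      using r by simp
    show "bounded_linear (\<lambda>h. \<integral>x. (h \<bullet> x) *\<^sub>R exp (\<theta> \<bullet> x) *\<^sub>R f x \<partial>\<mu>)"
    proof (rule bounded_linear_intro)
      fix h h' :: "real ^ 'n" and s :: real
      show "(\<integral>x. ((h + h') \<bullet> x) *\<^sub>R exp (\<theta> \<bullet> x) *\<^sub>R f x \<partial>\<mu>) =
        (\<integral>x. (h \<bullet> x) *\<^sub>R exp (\<theta> \<bullet> x) *\<^sub>R f x \<partial>\<mu>) + (\<integral>x. (h' \<bullet> x) *\<^sub>R exp (\<theta> \<bullet> x) *\<^sub>R f x \<partial>\<mu>)"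
        unfolding inner_add_left scaleR_add_left
        by (rule Bochner_Integration.integral_add[OF int_lin int_lin])
      show "(\<integral>x. ((s *\<^sub>R h) \<bullet> x) *\<^sub>R exp (\<theta> \<bullet> x) *\<^sub>R f x \<partial>\<mu>) =
        s *\<^sub>R (\<integral>x. (h \<bullet> x) *\<^sub>R exp (\<theta> \<bullet> x) *\<^sub>R f x \<partial>\<mu>)"
        by (simp flip: integral_scaleR_right add: mult.assoc)
      have "norm (\<integral>x. (h \<bullet> x) *\<^sub>R exp (\<theta> \<bullet> x) *\<^sub>R f x \<partial>\<mu>) \<le> (\<integral>x. (norm h / r) * norm (w x *\<^sub>R f x) \<partial>\<mu>)"
      proof (rule Bochner_Integration.integral_norm_bound_integral[OF int_lin])
        show "integrable \<mu> (\<lambda>x. (norm h / r) * norm (w x *\<^sub>R f x))"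
          by (rule integrable_mult_right[OF intw])
        fix x
        have "\<bar>(h \<bullet> x) * exp (\<theta> \<bullet> x)\<bar> * norm (f x) \<le> ((norm h / r) * w x) * norm (f x)"
          by (intro mult_right_mono lin_le) auto
        then show "norm ((h \<bullet> x) *\<^sub>R exp (\<theta> \<bullet> x) *\<^sub>R f x) \<le> (norm h / r) * norm (w x *\<^sub>R f x)"
          by (simp add: w_def abs_mult mult.assoc)
      qed
      then show "norm (\<integral>x. (h \<bullet> x) *\<^sub>R exp (\<theta> \<bullet> x) *\<^sub>R f x \<partial>\<mu>) \<le> norm h * (K / r)"
        by (simp only: integral_mult_right_zero K_def) simp
    qed
    fix \<eta>
    assume \<eta>: "\<eta> \<noteq> \<theta>" "dist \<eta> \<theta> < r / 2"
    let ?R = "\<lambda>x. exp (\<eta> \<bullet> x) *\<^sub>R f x - exp (\<theta> \<bullet> x) *\<^sub>R f x - ((\<eta> - \<theta>) \<bullet> x) *\<^sub>R exp (\<theta> \<bullet> x) *\<^sub>R f x"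
    have i: "integrable \<mu> (\<lambda>x. exp (\<theta> \<bullet> x) *\<^sub>R f x)"
      using r by (intro int_exp) simp
    have "(\<integral>x. exp (\<eta> \<bullet> x) *\<^sub>R f x \<partial>\<mu>) - (\<integral>x. exp (\<theta> \<bullet> x) *\<^sub>R f x \<partial>\<mu>)
        - (\<integral>x. ((\<eta> - \<theta>) \<bullet> x) *\<^sub>R exp (\<theta> \<bullet> x) *\<^sub>R f x \<partial>\<mu>) = (\<integral>x. ?R x \<partial>\<mu>)"
      by (subst Bochner_Integration.integral_diff,
          intro Bochner_Integration.integrable_diff int_exp \<eta> i, rule int_lin,
          subst Bochner_Integration.integral_diff[OF int_exp[OF \<eta>(2)] i], rule refl)
    also have "norm \<dots> \<le> (\<integral>x. ((norm (\<eta> - \<theta>))\<^sup>2 * (8 / r\<^sup>2)) * norm (w x *\<^sub>R f x) \<partial>\<mu>)"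
    proof (rule Bochner_Integration.integral_norm_bound_integral)
      show "integrable \<mu> ?R"
        by (intro Bochner_Integration.integrable_diff int_exp \<eta> i int_lin)
      show "integrable \<mu> (\<lambda>x. ((norm (\<eta> - \<theta>))\<^sup>2 * (8 / r\<^sup>2)) * norm (w x *\<^sub>R f x))"
        by (rule integrable_mult_right[OF intw])
      fix x
      have "?R x = (exp (\<eta> \<bullet> x) - exp (\<theta> \<bullet> x) - ((\<eta> - \<theta>) \<bullet> x) * exp (\<theta> \<bullet> x)) *\<^sub>R f x"
        by (simp add: algebra_simps)
      then have "norm (?R x) = \<bar>exp (\<eta> \<bullet> x) - exp (\<theta> \<bullet> x) - ((\<eta> - \<theta>) \<bullet> x) * exp (\<theta> \<bullet> x)\<bar> * norm (f x)"
        by simp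
      also have "\<dots> \<le> ((norm (\<eta> - \<theta>))\<^sup>2 * (8 / r\<^sup>2) * w x) * norm (f x)"
        by (intro mult_right_mono rem_le \<eta>) auto
      finally show "norm (?R x) \<le> ((norm (\<eta> - \<theta>))\<^sup>2 * (8 / r\<^sup>2)) * norm (w x *\<^sub>R f x)"
        by (simp add: w_def mult.assoc)
    qed
    also have "\<dots> = ((norm (\<eta> - \<theta>))\<^sup>2 * (8 / r\<^sup>2)) * K"
      by (simp only: integral_mult_right_zero K_def)
    finally have "norm ((\<integral>x. exp (\<eta> \<bullet> x) *\<^sub>R f x \<partial>\<mu>) - (\<integral>x. exp (\<theta> \<bullet> x) *\<^sub>R f x \<partial>\<mu>)
        - (\<integral>x. ((\<eta> - \<theta>) \<bullet> x) *\<^sub>R exp (\<theta> \<bullet> x) *\<^sub>R f x \<partial>\<mu>)) / norm (\<eta> - \<theta>)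
      \<le> ((norm (\<eta> - \<theta>))\<^sup>2 * (8 / r\<^sup>2)) * K / norm (\<eta> - \<theta>)"
      by (rule divide_right_mono) simp
    \<comment> \<open>Only one of the two factors \<open>norm (\<eta> - \<theta>)\<close> cancels,
      so the error quotient tends to 0.\<close>
    also have "\<dots> = norm (\<eta> - \<theta>) * (8 / r\<^sup>2 * K)"
      using \<eta> by (simp add: power2_eq_square)
    finally show "norm ((\<integral>x. exp (\<eta> \<bullet> x) *\<^sub>R f x \<partial>\<mu>) - (\<integral>x. exp (\<theta> \<bullet> x) *\<^sub>R f x \<partial>\<mu>)
        - (\<integral>x. ((\<eta> - \<theta>) \<bullet> x) *\<^sub>R exp (\<theta> \<bullet> x) *\<^sub>R f x \<partial>\<mu>)) / norm (\<eta> - \<theta>)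
      \<le> norm (\<eta> - \<theta>) * (8 / r\<^sup>2 * K)" .
  next
    show "((\<lambda>\<eta>. norm (\<eta> - \<theta>) * (8 / r\<^sup>2 * K)) \<longlongrightarrow> 0) (at \<theta>)"
      by (use r in \<open>auto intro!: tendsto_eq_intros\<close>)
  qed
qed

section \<open>Cumulant functions\<close>

definition nef_member :: "(real ^ 'n) measure \<Rightarrow> real ^ 'n \<Rightarrow> (real ^ 'n) measure" where
  "nef_member \<mu> \<theta> = density \<mu> (\<lambda>x. ennreal (exp (\<theta> \<bullet> x - cumulant \<mu> \<theta>)))"

definition mean :: "(real ^ 'n) measure \<Rightarrow> real ^ 'n" where
  "mean P = (\<integral>x. x \<partial>P)"

text \<open>The covariance matrix E[X X^T] - E[X] E[X]^T of \<open>P\<close>, encoded as its action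
  on \<open>h\<close> so that it can serve directly as a derivative.\<close>

definition covariance :: "(real ^ 'n) measure \<Rightarrow> real ^ 'n \<Rightarrow> real ^ 'n" where
  "covariance P h = (\<integral>x. (h \<bullet> x) *\<^sub>R x \<partial>P) - (h \<bullet> mean P) *\<^sub>R mean P"

lemma nef_eq_image: "nef \<mu> = nef_member \<mu> ` Theta \<mu>"
  by (simp add: nef_def nef_member_def)

lemma
  fixes M :: "real ^ 'n ^ 'n"
  assumes "invertible M"
  shows matrix_mult_matrix_inv: "M ** matrix_inv M = mat 1"
    and matrix_inv_mult_matrix: "matrix_inv M ** M = mat 1"
  using someI_ex[OF assms[unfolded invertible_def], folded matrix_inv_def] by blast+

section \<open>Laplace transform and moments of a generating measure\<close>

locale nef_generator =
  fixes \<mu> :: "(real ^ 'n) measure"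
  assumes generator: "\<mu> \<in> nef_generators"
begin

lemma sets_eq: "sets \<mu> = sets borel"
  using generator by (simp add: nef_generators_def)

lemma not_AE_hyperplane: "a \<noteq> 0 \<Longrightarrow> \<not> (AE x in \<mu>. a \<bullet> x = \<beta>)"
  using generator by (auto simp: nef_generators_def)

lemma borel_measurable_iff: "f \<in> borel_measurable \<mu> \<longleftrightarrow> f \<in> borel_measurable borel"
  by (rule arg_cong[where f = "\<lambda>A. f \<in> A", OF measurable_cong_sets[OF sets_eq refl]])

lemma open_Theta: "open (Theta \<mu>)" and Theta_subset: "Theta \<mu> \<subseteq> laplace_dom \<mu>"
  by (simp_all add: Theta_def interior_subset)

text \<open>Integrating the convexity inequality of the exponential makes the Laplace domain convex,
  and convexity passes to the interior. The segments obtained this way serve the injectivity of the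
  gradient.\<close>

lemma convex_Theta: "convex (Theta \<mu>)"
  unfolding Theta_def
proof (rule convex_interior, rule convexI)
  fix a b :: "real ^ 'n" and u v :: real
  assume a: "a \<in> laplace_dom \<mu>" and b: "b \<in> laplace_dom \<mu>" and uv: "0 \<le> u" "0 \<le> v" "u + v = 1"
  have "laplace \<mu> (u *\<^sub>R a + v *\<^sub>R b) \<le>
      (\<integral>\<^sup>+x. ennreal u * ennreal (exp (a \<bullet> x)) + ennreal v * ennreal (exp (b \<bullet> x)) \<partial>\<mu>)"
    unfolding laplace_def
  proof (rule nn_integral_mono)
    fix x
    have "exp (u *\<^sub>R (a \<bullet> x) + v *\<^sub>R (b \<bullet> x)) \<le> u * exp (a \<bullet> x) + v * exp (b \<bullet> x)"
      using convex_onD[OF exp_convex, of v "a \<bullet> x" "b \<bullet> x"] uv by (simp add: eq_diff_eq[symmetric])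
    then show "ennreal (exp ((u *\<^sub>R a + v *\<^sub>R b) \<bullet> x)) \<le>
        ennreal u * ennreal (exp (a \<bullet> x)) + ennreal v * ennreal (exp (b \<bullet> x))"
      using uv by (simp add: inner_add_left ennreal_leI flip: ennreal_mult ennreal_plus)
  qed
  also have "\<dots> = ennreal u * laplace \<mu> a + ennreal v * laplace \<mu> b"
    unfolding laplace_def by (subst nn_integral_add) (auto simp: borel_measurable_iff nn_integral_cmult)
  also have "\<dots> < \<infinity>"
    using a b by (simp add: laplace_dom_def ennreal_mult_less_top)
  finally show "u *\<^sub>R a + v *\<^sub>R b \<in> laplace_dom \<mu>"
    by (simp add: laplace_dom_def)
qed

definition partition :: "real ^ 'n \<Rightarrow> real" where
  "partition \<theta> = (\<integral>x. exp (\<theta> \<bullet> x) \<partial>\<mu>)"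

text \<open>Valid at every \<open>\<theta>\<close>: where the Laplace integral diverges,
  \<open>enn2real\<close> of infinity and the Bochner integral both have the default value
  0.\<close>

lemma cumulant_eq: "cumulant \<mu> \<theta> = ln (partition \<theta>)"
  unfolding cumulant_def laplace_def partition_def
  by (subst integral_eq_nn_integral) (auto simp: borel_measurable_iff)

lemma integrable_exp: "\<theta> \<in> Theta \<mu> \<Longrightarrow> integrable \<mu> (\<lambda>x. exp (\<theta> \<bullet> x))"
  by (rule integrable_exp_laplace_dom[OF sets_eq subsetD[OF Theta_subset]])

lemma partition_pos:
  assumes "\<theta> \<in> Theta \<mu>"
  shows "0 < partition \<theta>"
proof -
  have "partition \<theta> \<noteq> 0"
  proof
    assume "partition \<theta> = 0"
    then have "AE x in \<mu>. exp (\<theta> \<bullet> x) = 0"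
      unfolding partition_def
      by (subst (asm) integral_nonneg_eq_0_iff_AE[OF integrable_exp[OF assms]]) auto
    \<comment> \<open>The exponential never vanishes, so every property holds almost everywhere,
      including concentration on a hyperplane; this is how the zero measure is excluded.\<close>
    then have "AE x in \<mu>. (1 :: real ^ 'n) \<bullet> x = 0"
      by (rule eventually_mono) simp
    then show False
      using not_AE_hyperplane[of 1 0] by simp
  qed
  moreover have "0 \<le> partition \<theta>"
    unfolding partition_def by (rule integral_nonneg_AE) auto
  ultimately show ?thesis
    by simp
qed

lemma integral_nef_member:
  fixes f :: "real ^ 'n \<Rightarrow> 'b::{banach, second_countable_topology}"
  assumes "\<theta> \<in> Theta \<mu>" "f \<in> borel_measurable borel"
  shows "(\<integral>x. f x \<partial>nef_member \<mu> \<theta>) = (1 / partition \<theta>) *\<^sub>R (\<integral>x. exp (\<theta> \<bullet> x) *\<^sub>R f x \<partial>\<mu>)"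
proof -
  have "(\<integral>x. f x \<partial>nef_member \<mu> \<theta>) = (\<integral>x. exp (\<theta> \<bullet> x - cumulant \<mu> \<theta>) *\<^sub>R f x \<partial>\<mu>)"
    unfolding nef_member_def
    by (rule integral_density) (use assms in \<open>auto simp: borel_measurable_iff\<close>)
  also have "\<dots> = (\<integral>x. (1 / partition \<theta>) *\<^sub>R (exp (\<theta> \<bullet> x) *\<^sub>R f x) \<partial>\<mu>)"
    using partition_pos[OF assms(1)] by (simp add: exp_diff cumulant_eq)
  finally show ?thesis
    by (simp only: integral_scaleR_right)
qed

text \<open>The weight \<open>exp (r * norm x)\<close> pays for the polynomial factors. In the third
  claim only half of it is spent, and the remaining rate \<open>r / 2\<close> permits
  differentiating the first moment in turn.\<close>

lemma integrable_exp_moments: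
  assumes "\<theta> \<in> Theta \<mu>"
  shows "integrable \<mu> (\<lambda>x. exp (\<theta> \<bullet> x) *\<^sub>R x)"
    and "integrable \<mu> (\<lambda>x. exp (\<theta> \<bullet> x) *\<^sub>R (h \<bullet> x) *\<^sub>R x)"
    and "\<exists>r>0. integrable \<mu> (\<lambda>x. (exp (r * norm x) * exp (\<theta> \<bullet> x)) *\<^sub>R x)"
proof -
  obtain r where r: "0 < r" "integrable \<mu> (\<lambda>x. exp (r * norm x) * exp (\<theta> \<bullet> x))"
    using integrable_exp_norm[OF sets_eq assms] .
  have bound: "integrable \<mu> q" if [measurable]: "q \<in> borel_measurable borel"
    and q: "\<And>x. norm (q x) \<le> C * (exp (r * norm x) * exp (\<theta> \<bullet> x))" for C and q :: "real ^ 'n \<Rightarrow> real ^ 'n"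
  proof (rule Bochner_Integration.integrable_bound)
    show "integrable \<mu> (\<lambda>x. C * (exp (r * norm x) * exp (\<theta> \<bullet> x)))"
      using r(2) by (rule integrable_mult_right)
    show "AE x in \<mu>. norm (q x) \<le> norm (C * (exp (r * norm x) * exp (\<theta> \<bullet> x)))"
      using order_trans[OF q abs_ge_self] by simp
  qed (simp add: borel_measurable_iff)
  have half: "exp (r / 2 * norm x) * exp (r / 2 * norm x) = exp (r * norm x)" for x :: "real ^ 'n"
    by (simp flip: exp_add)
  show "integrable \<mu> (\<lambda>x. exp (\<theta> \<bullet> x) *\<^sub>R x)"
  proof (rule bound)
    fix x :: "real ^ 'n"
    show "norm (exp (\<theta> \<bullet> x) *\<^sub>R x) \<le> (1 / r) * (exp (r * norm x) * exp (\<theta> \<bullet> x))"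
      using mult_right_mono[OF norm_times_exp_le(1)[OF r(1), of x], of "exp (\<theta> \<bullet> x)"]
      by (simp add: mult.commute)
  qed simp
  show "integrable \<mu> (\<lambda>x. exp (\<theta> \<bullet> x) *\<^sub>R (h \<bullet> x) *\<^sub>R x)"
  proof (rule bound)
    fix x :: "real ^ 'n"
    have "\<bar>h \<bullet> x\<bar> * norm x \<le> norm h * norm x * norm x"
      by (intro mult_right_mono Cauchy_Schwarz_ineq2) auto
    also have "\<dots> \<le> norm h * ((2 / r\<^sup>2) * exp (r * norm x))"
      using mult_left_mono[OF norm_times_exp_le(2)[OF r(1), of x], of "norm h"]
      by (simp add: power2_eq_square)
    finally show "norm (exp (\<theta> \<bullet> x) *\<^sub>R (h \<bullet> x) *\<^sub>R x) \<le>
        (norm h * (2 / r\<^sup>2)) * (exp (r * norm x) * exp (\<theta> \<bullet> x))"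
      by (auto dest: mult_left_mono[of _ _ "exp (\<theta> \<bullet> x)"] simp: abs_mult ac_simps)
  qed simp
  have "integrable \<mu> (\<lambda>x. (exp (r / 2 * norm x) * exp (\<theta> \<bullet> x)) *\<^sub>R x)"
  proof (rule bound)
    fix x :: "real ^ 'n"
    have "(exp (r / 2 * norm x) * exp (\<theta> \<bullet> x)) * norm x \<le>
        (exp (r / 2 * norm x) * exp (\<theta> \<bullet> x)) * ((1 / (r / 2)) * exp (r / 2 * norm x))"
      using r by (intro mult_left_mono norm_times_exp_le) auto
    also have "\<dots> = (1 / (r / 2)) * (exp (r * norm x) * exp (\<theta> \<bullet> x))"
      unfolding half[symmetric] by (simp add: ac_simps)
    finally show "norm ((exp (r / 2 * norm x) * exp (\<theta> \<bullet> x)) *\<^sub>R x) \<le>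
        (1 / (r / 2)) * (exp (r * norm x) * exp (\<theta> \<bullet> x))"
      by simp
  qed simp
  then show "\<exists>r>0. integrable \<mu> (\<lambda>x. (exp (r * norm x) * exp (\<theta> \<bullet> x)) *\<^sub>R x)"
    using r(1) half_gt_zero by blast
qed

section \<open>Derivatives of the cumulant function\<close>

lemma partition_has_derivative:
  assumes "\<theta> \<in> Theta \<mu>"
  shows "(partition has_derivative (\<lambda>h. h \<bullet> (\<integral>x. exp (\<theta> \<bullet> x) *\<^sub>R x \<partial>\<mu>))) (at \<theta>)"
proof -
  obtain r where r: "0 < r" "integrable \<mu> (\<lambda>x. exp (r * norm x) * exp (\<theta> \<bullet> x))"
    using integrable_exp_norm[OF sets_eq assms] .
  have "((\<lambda>\<eta>. \<integral>x. exp (\<eta> \<bullet> x) *\<^sub>R (1::real) \<partial>\<mu>) has_derivative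
      (\<lambda>h. \<integral>x. (h \<bullet> x) *\<^sub>R exp (\<theta> \<bullet> x) *\<^sub>R (1::real) \<partial>\<mu>)) (at \<theta>)"
    by (rule has_derivative_integral_exp[OF sets_eq _ r(1)]) (use r(2) in auto)
  moreover have "(\<integral>x. (h \<bullet> x) *\<^sub>R exp (\<theta> \<bullet> x) *\<^sub>R (1::real) \<partial>\<mu>) = h \<bullet> (\<integral>x. exp (\<theta> \<bullet> x) *\<^sub>R x \<partial>\<mu>)" for h
    using integrable_exp_moments(1)[OF assms]
    by (simp flip: integral_inner_right add: mult.commute)
  ultimately show ?thesis
    by (simp add: partition_def[abs_def])
qed

lemma cumulant_has_derivative_mean:
  assumes "\<theta> \<in> Theta \<mu>"
  shows "(cumulant \<mu> has_derivative (\<lambda>h. h \<bullet> mean (nef_member \<mu> \<theta>))) (at \<theta>)"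
proof -
  have "((\<lambda>\<eta>. ln (partition \<eta>)) has_derivative
      (\<lambda>h. (h \<bullet> (\<integral>x. exp (\<theta> \<bullet> x) *\<^sub>R x \<partial>\<mu>)) * inverse (partition \<theta>))) (at \<theta>)"
    by (rule has_derivative_ln[OF partition_pos[OF assms] partition_has_derivative[OF assms]])
  then show ?thesis
    by (simp add: cumulant_eq[abs_def] mean_def integral_nef_member[OF assms] divide_inverse mult.commute)
qed

lemma cumulant_grad_eq_mean:
  assumes "\<theta> \<in> Theta \<mu>"
  shows "cumulant_grad \<mu> \<theta> = mean (nef_member \<mu> \<theta>)"
  unfolding cumulant_grad_def gderiv_def
proof (rule the_equality)
  fix D
  assume "(cumulant \<mu> has_derivative (\<lambda>h. h \<bullet> D)) (at \<theta>)"
  from has_derivative_unique[OF this cumulant_has_derivative_mean[OF assms]]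
  show "D = mean (nef_member \<mu> \<theta>)"
    by (metis inner_commute vector_eq_rdot)
qed (rule cumulant_has_derivative_mean[OF assms])

lemma cumulant_has_derivative:
  "\<theta> \<in> Theta \<mu> \<Longrightarrow> (cumulant \<mu> has_derivative (\<lambda>h. h \<bullet> cumulant_grad \<mu> \<theta>)) (at \<theta>)"
  using cumulant_has_derivative_mean by (simp only: cumulant_grad_eq_mean)

text \<open>The mean is the unnormalised first moment divided by \<open>partition\<close>. Both are
  differentiable integrals, and the quotient rule produces the second moment minus the product of
  the means.\<close>

lemma cumulant_grad_has_derivative_covariance:
  assumes "\<theta> \<in> Theta \<mu>"
  shows "(cumulant_grad \<mu> has_derivative covariance (nef_member \<mu> \<theta>)) (at \<theta>)"
proof -
  define G where "G \<eta> = (\<integral>x. exp (\<eta> \<bullet> x) *\<^sub>R x \<partial>\<mu>)" for \<eta>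
  define H where "H h = (\<integral>x. (h \<bullet> x) *\<^sub>R exp (\<theta> \<bullet> x) *\<^sub>R x \<partial>\<mu>)" for h
  obtain r where r: "0 < r" "integrable \<mu> (\<lambda>x. (exp (r * norm x) * exp (\<theta> \<bullet> x)) *\<^sub>R x)"
    using integrable_exp_moments(3)[OF assms] by blast
  have G: "(G has_derivative H) (at \<theta>)"
    unfolding G_def H_def by (rule has_derivative_integral_exp[OF sets_eq _ r]) simp
  have mean: "mean (nef_member \<mu> \<eta>) = (1 / partition \<eta>) *\<^sub>R G \<eta>" if "\<eta> \<in> Theta \<mu>" for \<eta>
    using that by (simp add: mean_def integral_nef_member G_def)
  have "((\<lambda>\<eta>. inverse (partition \<eta>) *\<^sub>R G \<eta>) has_derivative
      (\<lambda>h. inverse (partition \<theta>) *\<^sub>R H h +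
        (- (inverse (partition \<theta>) * (h \<bullet> G \<theta>) * inverse (partition \<theta>))) *\<^sub>R G \<theta>)) (at \<theta>)"
    using partition_pos[OF assms]
    by (intro has_derivative_scaleR[OF Deriv.has_derivative_inverse[OF _
            partition_has_derivative[OF assms, folded G_def]] G]) simp
  also have "(\<lambda>h. inverse (partition \<theta>) *\<^sub>R H h +
        (- (inverse (partition \<theta>) * (h \<bullet> G \<theta>) * inverse (partition \<theta>))) *\<^sub>R G \<theta>) =
      covariance (nef_member \<mu> \<theta>)"
    using assms
    by (simp add: fun_eq_iff covariance_def mean integral_nef_member[OF assms] H_def divide_inverse
        mult.commute mult.left_commute)
  finally show ?thesis
    by (rule has_derivative_transform_within_open[OF _ open_Theta assms])
      (simp add: cumulant_grad_eq_mean mean divide_inverse)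
qed

lemma cumulant_hess_works:
  assumes "\<theta> \<in> Theta \<mu>"
  shows "(cumulant_grad \<mu> has_derivative (*v) (cumulant_hess \<mu> \<theta>)) (at \<theta>)"
proof -
  have "cumulant_grad \<mu> differentiable at \<theta>"
    using cumulant_grad_has_derivative_covariance[OF assms] by (rule differentiableI)
  then show ?thesis
    unfolding cumulant_hess_def by (rule jacobian_works[THEN iffD1])
qed

lemma cumulant_hess_mult_vec:
  assumes "\<theta> \<in> Theta \<mu>"
  shows "cumulant_hess \<mu> \<theta> *v h = covariance (nef_member \<mu> \<theta>) h"
proof -
  have "(*v) (cumulant_hess \<mu> \<theta>) = covariance (nef_member \<mu> \<theta>)"
    using cumulant_hess_works[OF assms] cumulant_grad_has_derivative_covariance[OF assms]
    by (rule has_derivative_unique)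
  then show ?thesis
    by simp
qed

lemma cumulant_hess_eq:
  assumes "\<theta> \<in> Theta \<mu>"
  shows "cumulant_hess \<mu> \<theta> = matrix (covariance (nef_member \<mu> \<theta>))"
proof -
  have "covariance (nef_member \<mu> \<theta>) = (*v) (cumulant_hess \<mu> \<theta>)"
    by (rule ext, rule cumulant_hess_mult_vec[OF assms, symmetric])
  then show ?thesis
    by simp
qed

text \<open>The quadratic form is the variance of \<open>h \<bullet> x\<close> under the family
  member. Were it zero, \<open>h \<bullet> x\<close> would be almost everywhere constant and
  \<open>\<mu>\<close> concentrated on a hyperplane.\<close>

lemma cumulant_hess_pos:
  assumes \<theta>: "\<theta> \<in> Theta \<mu>" and h: "h \<noteq> 0"
  shows "0 < h \<bullet> (cumulant_hess \<mu> \<theta> *v h)"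
proof -
  define Z where "Z = partition \<theta>"
  define m where "m = mean (nef_member \<mu> \<theta>)"
  \<comment> \<open>The centred square with the unnormalised weight, so that its integral is
    \<open>Z\<close> times the variance.\<close>
  define q where "q x = (h \<bullet> x - h \<bullet> m)\<^sup>2 * exp (\<theta> \<bullet> x)" for x
  have Z: "0 < Z"
    unfolding Z_def by (rule partition_pos[OF \<theta>])
  note int0 = integrable_exp[OF \<theta>]
  note int1 = integrable_inner_right[OF integrable_exp_moments(1)[OF \<theta>], of h]
  note int2 = integrable_inner_right[OF integrable_exp_moments(2)[OF \<theta>, of h], of h]
  have q: "q x = h \<bullet> (exp (\<theta> \<bullet> x) *\<^sub>R (h \<bullet> x) *\<^sub>R x) - (2 * (h \<bullet> m)) * (h \<bullet> (exp (\<theta> \<bullet> x) *\<^sub>R x))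
      + (h \<bullet> m)\<^sup>2 * exp (\<theta> \<bullet> x)" for x
    by (simp add: q_def power2_eq_square algebra_simps)
  have m: "(\<integral>x. exp (\<theta> \<bullet> x) *\<^sub>R x \<partial>\<mu>) = Z *\<^sub>R m"
    using Z by (simp add: m_def mean_def integral_nef_member[OF \<theta>] Z_def)
  have int_q: "integrable \<mu> q"
    unfolding q[abs_def]
    by (intro Bochner_Integration.integrable_add Bochner_Integration.integrable_diff
        integrable_mult_right int0 int1 int2)
  have "(\<integral>x. q x \<partial>\<mu>) = h \<bullet> (\<integral>x. exp (\<theta> \<bullet> x) *\<^sub>R (h \<bullet> x) *\<^sub>R x \<partial>\<mu>) - Z * (h \<bullet> m)\<^sup>2"
    unfolding q
    using int0 int1 int2 integrable_exp_moments[OF \<theta>]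
    by (simp add: m Z_def[symmetric] partition_def[symmetric] power2_eq_square del: inner_scaleR_right)
      (simp add: algebra_simps)
  also have "\<dots> = Z * (h \<bullet> (cumulant_hess \<mu> \<theta> *v h))"
    using Z by (simp add: cumulant_hess_mult_vec[OF \<theta>] covariance_def integral_nef_member[OF \<theta>]
        m_def[symmetric] Z_def[symmetric] inner_diff_right power2_eq_square right_diff_distrib)
  finally have eq: "(\<integral>x. q x \<partial>\<mu>) = Z * (h \<bullet> (cumulant_hess \<mu> \<theta> *v h))" .
  have "0 \<le> (\<integral>x. q x \<partial>\<mu>)"
    by (rule integral_nonneg_AE) (simp add: q_def)
  moreover have "(\<integral>x. q x \<partial>\<mu>) \<noteq> 0"
  proof
    assume "(\<integral>x. q x \<partial>\<mu>) = 0"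
    then have "AE x in \<mu>. q x = 0"
      by (subst (asm) integral_nonneg_eq_0_iff_AE[OF int_q]) (auto simp: q_def)
    then have "AE x in \<mu>. h \<bullet> x = h \<bullet> m"
      by (simp add: q_def)
    with not_AE_hyperplane[OF h] show False
      by blast
  qed
  ultimately show ?thesis
    using Z unfolding eq by (auto simp: less_le zero_le_mult_iff)
qed

lemma invertible_cumulant_hess:
  assumes "\<theta> \<in> Theta \<mu>"
  shows "invertible (cumulant_hess \<mu> \<theta>)"
proof -
  have "h = 0" if "cumulant_hess \<mu> \<theta> *v h = 0" for h
    using cumulant_hess_pos[OF assms, of h] that by auto
  then show ?thesis
    by (simp add: invertible_left_inverse matrix_left_invertible_ker)
qed

text \<open>Along a segment of \<^term>\<open>Theta \<mu>\<close> the gradient, projected on the direction of the segment, has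
  positive derivative.\<close>

lemma inj_on_cumulant_grad: "inj_on (cumulant_grad \<mu>) (Theta \<mu>)"
proof (rule inj_onI, rule ccontr)
  fix a b
  assume a: "a \<in> Theta \<mu>" and b: "b \<in> Theta \<mu>" and eq: "cumulant_grad \<mu> a = cumulant_grad \<mu> b"
    and "a \<noteq> b"
  define \<phi> where "\<phi> t = (b - a) \<bullet> cumulant_grad \<mu> (a + t *\<^sub>R (b - a))" for t
  have "\<phi> 0 < \<phi> 1"
  proof (rule DERIV_pos_imp_increasing[of 0 1 \<phi>])
    fix t :: real
    assume t: "0 \<le> t" "t \<le> 1"
    have p: "a + t *\<^sub>R (b - a) \<in> Theta \<mu>"
      using convexD_alt[OF convex_Theta a b t] by (simp add: algebra_simps)
    have "((\<lambda>t. a + t *\<^sub>R (b - a)) has_derivative (\<lambda>s. s *\<^sub>R (b - a))) (at t)"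
      by (auto intro!: derivative_eq_intros)
    from has_derivative_inner_right[OF has_derivative_compose[of "\<lambda>t. a + t *\<^sub>R (b - a)",
          OF this cumulant_hess_works[OF p]]]
    have "(\<phi> has_derivative (\<lambda>s. (b - a) \<bullet> (cumulant_hess \<mu> (a + t *\<^sub>R (b - a)) *v (s *\<^sub>R (b - a))))) (at t)"
      unfolding \<phi>_def .
    then have "DERIV \<phi> t :> (b - a) \<bullet> (cumulant_hess \<mu> (a + t *\<^sub>R (b - a)) *v (b - a))"
      by (simp add: has_field_derivative_def matrix_vector_mult_scaleR mult_commute_abs)
    with cumulant_hess_pos[OF p, of "b - a"] \<open>a \<noteq> b\<close>
    show "\<exists>y. DERIV \<phi> t :> y \<and> 0 < y"
      by auto
  qed simp
  with eq show False
    by (simp add: \<phi>_def)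
qed

section \<open>Inversion of the mean map\<close>

lemma continuous_on_cumulant_grad: "continuous_on (Theta \<mu>) (cumulant_grad \<mu>)"
  by (auto intro!: continuous_at_imp_continuous_on has_derivative_continuous[OF cumulant_hess_works])

lemma open_image_cumulant_grad: "open U \<Longrightarrow> U \<subseteq> Theta \<mu> \<Longrightarrow> open (cumulant_grad \<mu> ` U)"
  by (rule invariance_of_domain[OF continuous_on_subset[OF continuous_on_cumulant_grad] _
        inj_on_subset[OF inj_on_cumulant_grad]])

lemma mean_inv_cumulant_grad: "\<theta> \<in> Theta \<mu> \<Longrightarrow> mean_inv \<mu> (cumulant_grad \<mu> \<theta>) = \<theta>"
  by (simp add: mean_inv_def inj_on_cumulant_grad)

text \<open>Inverse function theorem, applied to the global inverse that injectivity on
  \<open>Theta \<mu>\<close> supplies.\<close>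

lemma mean_inv_has_derivative:
  assumes "\<theta> \<in> Theta \<mu>"
  shows "(mean_inv \<mu> has_derivative (*v) (matrix_inv (cumulant_hess \<mu> \<theta>))) (at (cumulant_grad \<mu> \<theta>))"
proof (rule has_derivative_inverse_strong[OF open_Theta assms continuous_on_cumulant_grad
      mean_inv_cumulant_grad cumulant_hess_works[OF assms]])
  show "(*v) (cumulant_hess \<mu> \<theta>) \<circ> (*v) (matrix_inv (cumulant_hess \<mu> \<theta>)) = id"
    by (simp add: fun_eq_iff matrix_vector_mul_assoc matrix_mult_matrix_inv invertible_cumulant_hess assms)
qed

end

text \<open>The gradient and the Hessian of the cumulant function depend only on the member
  \<^term>\<open>nef_member \<mu> \<theta>\<close> of the family, through its mean and its covariance. So they do not see which
  generator was chosen.\<close>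

lemma
  assumes "\<mu> \<in> nef_generators"
  shows means_dom_nef: "means_dom (nef \<mu>) = cumulant_grad \<mu> ` Theta \<mu>"
    and variance_fun_nef: "\<theta> \<in> Theta \<mu> \<Longrightarrow>
      variance_fun (nef \<mu>) (cumulant_grad \<mu> \<theta>) = cumulant_hess \<mu> \<theta>"
proof -
  interpret nef_generator \<mu>
    using assms by unfold_locales
  define \<mu>' where "\<mu>' = Defs.generator (nef \<mu>)"
  have \<mu>': "\<mu>' \<in> nef_generators \<and> nef \<mu> = nef \<mu>'"
    unfolding \<mu>'_def generator_def using assms by (intro someI) auto
  then interpret gen: nef_generator \<mu>'
    by unfold_locales simp
  have "cumulant_grad \<mu> ` Theta \<mu> = mean ` nef \<mu>"
    by (auto simp: nef_eq_image cumulant_grad_eq_mean image_iff)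
  moreover have "cumulant_grad \<mu>' ` Theta \<mu>' = mean ` nef \<mu>'"
    by (auto simp: nef_eq_image gen.cumulant_grad_eq_mean image_iff)
  ultimately show "means_dom (nef \<mu>) = cumulant_grad \<mu> ` Theta \<mu>"
    unfolding means_dom_def \<mu>'_def[symmetric] using \<mu>' by simp
  assume \<theta>: "\<theta> \<in> Theta \<mu>"
  then have "nef_member \<mu> \<theta> \<in> nef \<mu>'"
    using \<mu>' by (auto simp: nef_eq_image)
  \<comment> \<open>Under the chosen generator the same measure may carry another parameter.\<close>
  then obtain \<theta>' where \<theta>': "\<theta>' \<in> Theta \<mu>'" "nef_member \<mu> \<theta> = nef_member \<mu>' \<theta>'"
    by (auto simp: nef_eq_image)
  then have "cumulant_grad \<mu> \<theta> = cumulant_grad \<mu>' \<theta>'" "cumulant_hess \<mu> \<theta> = cumulant_hess \<mu>' \<theta>'"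
    using \<theta> by (simp_all add: cumulant_grad_eq_mean gen.cumulant_grad_eq_mean
        cumulant_hess_eq gen.cumulant_hess_eq)
  then show "variance_fun (nef \<mu>) (cumulant_grad \<mu> \<theta>) = cumulant_hess \<mu> \<theta>"
    unfolding variance_fun_def \<mu>'_def[symmetric] using \<theta>' by (simp add: gen.mean_inv_cumulant_grad)
qed

section \<open>Projective maps\<close>

lemma block_vec_eq_iff: "block_vec x t = block_vec y s \<longleftrightarrow> x = y \<and> t = s"
  by (auto simp: block_vec_def vec_eq_iff split: sum.splits)

lemma block_vec_add: "block_vec x t + block_vec y s = block_vec (x + y) (t + s)"
  by (auto simp: block_vec_def vec_eq_iff split: sum.split)

lemma block_vec_scaleR: "r *\<^sub>R block_vec x t = block_vec (r *\<^sub>R x) (r * t)"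
  by (auto simp: block_vec_def vec_eq_iff split: sum.split)

lemma transpose_block_mat: "transpose (block_mat A b c d) = block_mat (transpose A) c b d"
  by (auto simp: block_mat_def block_vec_def transpose_def vec_eq_iff split: sum.split)

lemma inner_transpose_mult:
  fixes M :: "real ^ 'n ^ 'm"
  shows "(transpose M *v w) \<bullet> x = w \<bullet> (M *v x)"
  by (simp add: dot_lmul_matrix)

lemma invertible_mult_vec_inj:
  fixes M :: "real ^ 'n ^ 'n"
  assumes "invertible M" "M *v x = M *v y"
  shows "x = y"
proof -
  have "matrix_inv M *v (M *v x) = matrix_inv M *v (M *v y)"
    using assms(2) by simp
  then show ?thesis
    by (simp add: matrix_vector_mul_assoc matrix_inv_mult_matrix[OF assms(1)])
qed

lemma den_block_mat: "den (block_mat A b c d) m = c \<bullet> m + d"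
  and hmap_block_mat: "hmap (block_mat A b c d) m = (1 / (c \<bullet> m + d)) *\<^sub>R (A *v m + b)"
  by (simp_all add: den_def hmap_def)

locale projective_map =
  fixes A :: "real ^ 'n ^ 'n" and b c :: "real ^ 'n" and d :: real
    and g :: "real ^ ('n::finite + 1) ^ ('n::finite + 1)"
  assumes g_eq: "g = block_mat A b c d" and invertible_g: "invertible g"
begin

text \<open>Injectivity of \<open>g\<close> read blockwise. It is applied to \<open>(m, 1)\<close>
  for a nonzero denominator, and to a tangent vector minus a multiple of \<open>(m, 1)\<close> for
  the invertibility of the Jacobian.\<close>

lemma block_kernel:
  assumes "A *v x + t *\<^sub>R b = 0" "c \<bullet> x + d * t = 0"
  shows "x = 0 \<and> t = 0"
proof -
  have "g *v block_vec x t = g *v block_vec 0 0"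
    by (simp add: g_eq block_mat_mult_vec assms)
  from invertible_mult_vec_inj[OF invertible_g this] show ?thesis
    by (simp add: block_vec_eq_iff)
qed

lemma den_eq: "den g m = c \<bullet> m + d"
  by (simp add: g_eq den_block_mat)

lemma den_hmap: "den g m \<noteq> 0 \<Longrightarrow> den g m *\<^sub>R hmap g m = A *v m + b"
  by (simp add: g_eq den_block_mat hmap_block_mat)

text \<open>If the denominator vanished, \<open>(m, 1)\<close> would lie in the kernel of
  \<open>g\<close>. An identity free of division thus yields the nonzero denominator as well, which
  is not known in advance when the block equation is differentiated.\<close>

lemma hmap_unique:
  assumes "den g m *\<^sub>R y = A *v m + b"
  shows "den g m \<noteq> 0" "hmap g m = y"
proof -
  show nz: "den g m \<noteq> 0"
  proof
    assume "den g m = 0"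
    with assms block_kernel[of m 1] show False
      by (simp add: den_eq)
  qed
  show "hmap g m = y"
    using den_hmap[OF nz] nz unfolding assms[symmetric] by simp
qed

section \<open>Derivative of the projective map and the action on variance functions\<close>

abbreviation J :: "real ^ 'n \<Rightarrow> real ^ 'n ^ 'n" where
  "J m \<equiv> jacobian (hmap g) (at m)"

text \<open>Quotient rule. The second identity is cleared of the denominator and expressed through
  \<open>hmap g m\<close>, the form that transposes into the differential of the block
  equation.\<close>

lemma
  assumes den: "den g m \<noteq> 0"
  shows hmap_has_derivative: "(hmap g has_derivative (*v) (J m)) (at m)"
    and den_jacobian: "den g m *\<^sub>R (J m *v y) = A *v y - (c \<bullet> y) *\<^sub>R hmap g m"
proof -
  let ?h' = "\<lambda>y. (1 / den g m) *\<^sub>R (A *v y - (c \<bullet> y) *\<^sub>R hmap g m)"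
  have "((\<lambda>x. inverse (c \<bullet> x + d) *\<^sub>R (A *v x + b)) has_derivative
      (\<lambda>y. inverse (c \<bullet> m + d) *\<^sub>R (A *v y) +
        (- (inverse (c \<bullet> m + d) * (c \<bullet> y) * inverse (c \<bullet> m + d))) *\<^sub>R (A *v m + b))) (at m)"
  proof (rule has_derivative_scaleR[OF Deriv.has_derivative_inverse])
    show "c \<bullet> m + d \<noteq> 0"
      using den by (simp add: den_eq)
    show "((\<lambda>x. c \<bullet> x + d) has_derivative (\<lambda>y. c \<bullet> y)) (at m)"
      by (auto intro!: derivative_eq_intros)
    show "((\<lambda>x. A *v x + b) has_derivative (\<lambda>y. A *v y)) (at m)"
      by (intro has_derivative_add_const linear_imp_has_derivative) simp
  qed
  also have "(\<lambda>y. inverse (c \<bullet> m + d) *\<^sub>R (A *v y) +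
        (- (inverse (c \<bullet> m + d) * (c \<bullet> y) * inverse (c \<bullet> m + d))) *\<^sub>R (A *v m + b)) = ?h'"
    by (simp add: fun_eq_iff g_eq den_block_mat hmap_block_mat divide_inverse scaleR_diff_right mult.commute
        mult.left_commute)
  also have "(\<lambda>x. inverse (c \<bullet> x + d) *\<^sub>R (A *v x + b)) = hmap g"
    by (simp add: fun_eq_iff g_eq hmap_block_mat divide_inverse)
  finally have h': "(hmap g has_derivative ?h') (at m)" .
  then show J: "(hmap g has_derivative (*v) (J m)) (at m)"
    by (intro jacobian_works[THEN iffD1] differentiableI)
  from has_derivative_unique[OF J h'] have "J m *v y = ?h' y"
    by meson
  then show "den g m *\<^sub>R (J m *v y) = A *v y - (c \<bullet> y) *\<^sub>R hmap g m"
    using den by simp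
qed

lemma invertible_jacobian_hmap:
  assumes den: "den g m \<noteq> 0"
  shows "invertible (J m)"
proof -
  have "y = 0" if "J m *v y = 0" for y
  proof -
    \<comment> \<open>Chosen so that the pair of \<open>y - s *\<^sub>R m\<close> and
      \<open>- s\<close> lies in the kernel of \<open>g\<close>; then \<open>s\<close> vanishes, and
      with it \<open>y\<close>.\<close>
    define s where "s = (c \<bullet> y) / den g m"
    have s: "s * den g m = c \<bullet> y"
      using den by (simp add: s_def)
    have "A *v y = (c \<bullet> y) *\<^sub>R hmap g m"
      using den_jacobian[OF den, of y] that by simp
    also have "\<dots> = s *\<^sub>R (A *v m + b)"
      by (simp flip: s den_hmap[OF den])
    finally have "A *v (y - s *\<^sub>R m) + (- s) *\<^sub>R b = 0"
      by (simp add: matrix_vector_mult_diff_distrib matrix_vector_mult_scaleR scaleR_add_right)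
    moreover have "c \<bullet> (y - s *\<^sub>R m) + d * (- s) = 0"
      using s by (simp add: den_eq inner_diff_right algebra_simps)
    ultimately show "y = 0"
      using block_kernel by fastforce
  qed
  then show ?thesis
    by (simp add: invertible_left_inverse matrix_left_invertible_ker)
qed

text \<open>Adjoint of \<open>den_jacobian\<close>. With \<open>w\<close> the differential of
  \<open>\<theta>\<close> and \<open>hmap g m\<close> the mean in the second family, the right side
  is the differential of the upper block.\<close>

lemma den_transpose_jacobian:
  assumes den: "den g m \<noteq> 0"
  shows "den g m *\<^sub>R (transpose (J m) *v w) = transpose A *v w - (w \<bullet> hmap g m) *\<^sub>R c"
proof (rule vector_eq_rdot[THEN iffD1], rule allI)
  fix x
  have "(den g m *\<^sub>R (transpose (J m) *v w)) \<bullet> x = w \<bullet> (den g m *\<^sub>R (J m *v x))"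
    by (simp only: inner_scaleR_left inner_scaleR_right inner_transpose_mult)
  also have "\<dots> = (transpose A *v w - (w \<bullet> hmap g m) *\<^sub>R c) \<bullet> x"
    by (simp only: den_jacobian[OF den] inner_diff_left inner_diff_right inner_transpose_mult
        inner_scaleR_left inner_scaleR_right mult.commute)
  finally show "(den g m *\<^sub>R (transpose (J m) *v w)) \<bullet> x = \<dots>" .
qed

text \<open>Multiplying by the Jacobian on the left and its transpose on the right removes both
  inverses. The result has the shape that the chain rule delivers, and it is used in both directions
  of the theorem.\<close>

lemma T_map_eq_iff:
  assumes den: "den g m \<noteq> 0"
  shows "T_map g V m = M \<longleftrightarrow>
    (\<forall>w. V (hmap g m) *v w = den g m *\<^sub>R (J m *v (M *v (transpose (J m) *v w))))"
    (is "?L \<longleftrightarrow> ?R")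
proof -
  note inv = invertible_jacobian_hmap[OF den]
  have invT: "invertible (transpose (J m))"
    using inv by (rule transpose_invertible)
  have cancel [simp]: "J m *v (matrix_inv (J m) *v x) = x" "matrix_inv (J m) *v (J m *v x) = x"
    "transpose (J m) *v (matrix_inv (transpose (J m)) *v x) = x"
    "matrix_inv (transpose (J m)) *v (transpose (J m) *v x) = x" for x
    by (simp_all only: matrix_vector_mul_assoc matrix_mult_matrix_inv matrix_inv_mult_matrix inv invT
        matrix_vector_mul_lid)
  have T: "T_map g V m *v x = (1 / den g m) *\<^sub>R
      (matrix_inv (J m) *v (V (hmap g m) *v (matrix_inv (transpose (J m)) *v x)))" for x
    by (simp only: T_map_def Let_def scaleR_matrix_vector_assoc[symmetric] matrix_vector_mul_assoc
        matrix_mul_assoc)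
  show ?thesis
  proof
    assume ?L
    then have "M *v x = (1 / den g m) *\<^sub>R
      (matrix_inv (J m) *v (V (hmap g m) *v (matrix_inv (transpose (J m)) *v x)))" for x
      using T by simp
    then show ?R
      using den by (simp only: cancel matrix_vector_mult_scaleR) simp
  next
    assume ?R
    then have "T_map g V m *v x = M *v x" for x
      using den by (simp only: T cancel matrix_vector_mult_scaleR) simp
    then show ?L
      by (simp add: matrix_eq)
  qed
qed

section \<open>Linear algebra of the block equation\<close>

lemma linear_upper_block_solve:
  "linear (\<lambda>p. \<chi> i. (matrix_inv (transpose g) *v block_vec (fst p) (snd p)) $ Inl i)"
proof (rule linearI)
  fix p q :: "(real ^ 'n) \<times> real" and r :: real
  show "(\<chi> i. (matrix_inv (transpose g) *v block_vec (fst (p + q)) (snd (p + q))) $ Inl i) =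
      (\<chi> i. (matrix_inv (transpose g) *v block_vec (fst p) (snd p)) $ Inl i) +
      (\<chi> i. (matrix_inv (transpose g) *v block_vec (fst q) (snd q)) $ Inl i)"
    by (simp add: vec_eq_iff matrix_vector_right_distrib flip: block_vec_add)
  show "(\<chi> i. (matrix_inv (transpose g) *v block_vec (fst (r *\<^sub>R p)) (snd (r *\<^sub>R p))) $ Inl i) =
      r *\<^sub>R (\<chi> i. (matrix_inv (transpose g) *v block_vec (fst p) (snd p)) $ Inl i)"
    by (simp add: vec_eq_iff matrix_vector_mult_scaleR flip: block_vec_scaleR)
qed

lemma block_equation_iff:
  "block_vec l (- k) = block_mat (transpose A) c b d *v block_vec t (- s) + block_vec l0 (- k0) \<longleftrightarrow>
    l = transpose A *v t - s *\<^sub>R c + l0 \<and> - k = b \<bullet> t - d * s - k0"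
  by (simp add: block_mat_mult_vec block_vec_add block_vec_eq_iff del: transpose_matrix_vector)

text \<open>The numerator \<open>A *v m + b\<close> paired with \<open>w\<close>. Contracting the
  differential of the upper block with \<open>m\<close> gives minus that of the lower block, so
  solving the upper equation to first order also solves the lower one.\<close>

lemma tangent_equation:
  assumes "den g m \<noteq> 0"
  shows "(transpose A *v w - (w \<bullet> hmap g m) *\<^sub>R c) \<bullet> m = - (b \<bullet> w) + d * (w \<bullet> hmap g m)"
proof -
  have "w \<bullet> (A *v m + b) = den g m * (w \<bullet> hmap g m)"
    by (simp flip: den_hmap[OF assms])
  then show ?thesis
    by (simp add: inner_diff_left inner_transpose_mult den_eq inner_add_right algebra_simps
        inner_commute[of b w] del: transpose_matrix_vector)
qed

section \<open>Comparison of the two families\<close>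

lemma nef_eq_T_imp_block_equation:
  assumes "\<mu> \<in> nef_generators" "\<nu> \<in> nef_generators" and "nef_eq_T (nef \<mu>) g (nef \<nu>)"
  shows "\<exists>U \<theta> l0 k0. open U \<and> U \<noteq> {} \<and> U \<subseteq> Theta \<mu> \<and> \<theta> \<in> U \<rightarrow> Theta \<nu> \<and>
    (\<forall>l\<in>U. block_vec l (- cumulant \<mu> l) =
      block_mat (transpose A) c b d *v block_vec (\<theta> l) (- cumulant \<nu> (\<theta> l)) + block_vec l0 (- k0))"
proof -
  interpret \<mu>: nef_generator \<mu> by unfold_locales fact
  interpret \<nu>: nef_generator \<nu> by unfold_locales fact
  obtain W where W: "open W" "W \<noteq> {}" "W \<subseteq> cumulant_grad \<mu> ` Theta \<mu>"
      "W \<subseteq> T_dom g (cumulant_grad \<nu> ` Theta \<nu>)"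
      "\<And>m. m \<in> W \<Longrightarrow> variance_fun (nef \<mu>) m = T_map g (variance_fun (nef \<nu>)) m"
    using assms(3) unfolding nef_eq_T_def means_dom_nef[OF assms(1)] means_dom_nef[OF assms(2)]
    by blast
  \<comment> \<open>\<open>W\<close> is pulled back to the parameters and shrunk to a ball, because
    a vanishing derivative will force constancy on a convex set.\<close>
  have "open (Theta \<mu> \<inter> cumulant_grad \<mu> -` W)"
    using \<mu>.continuous_on_cumulant_grad \<mu>.open_Theta W(1) by (rule continuous_open_preimage)
  moreover obtain l1 where "l1 \<in> Theta \<mu> \<inter> cumulant_grad \<mu> -` W"
    using W(2,3) by blast
  ultimately obtain e where e: "0 < e" "ball l1 e \<subseteq> Theta \<mu> \<inter> cumulant_grad \<mu> -` W"
    by (rule openE)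
  define U where "U = ball l1 e"
  define M where "M = cumulant_grad \<mu>"
  define \<theta> where "\<theta> l = mean_inv \<nu> (hmap g (M l))" for l
  have U: "open U" "convex U" "U \<noteq> {}" "U \<subseteq> Theta \<mu>" "l \<in> U \<Longrightarrow> M l \<in> W" for l
    using e by (auto simp: U_def M_def)
  have den: "0 < den g (M l)" and \<theta>: "\<theta> l \<in> Theta \<nu>" "cumulant_grad \<nu> (\<theta> l) = hmap g (M l)"
    if l: "l \<in> U" for l
  proof -
    obtain t where t: "t \<in> Theta \<nu>" "hmap g (M l) = cumulant_grad \<nu> t" and "0 < den g (M l)"
      using U(5)[OF l] W(4) by (auto simp: T_dom_def)
    then show "0 < den g (M l)" "\<theta> l \<in> Theta \<nu>" "cumulant_grad \<nu> (\<theta> l) = hmap g (M l)"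
      by (simp_all add: \<theta>_def \<nu>.mean_inv_cumulant_grad)
  qed
  \<comment> \<open>Chain rule for \<open>\<theta>\<close>: the Hessian for \<open>\<mu>\<close>,
    the Jacobian of \<open>hmap g\<close>, then the inverse Hessian for
    \<open>\<nu>\<close>.\<close>
  define D where "D l v = matrix_inv (cumulant_hess \<nu> (\<theta> l)) *v (J (M l) *v (cumulant_hess \<mu> l *v v))"
    for l v
  have \<theta>': "(\<theta> has_derivative D l) (at l)" if l: "l \<in> U" for l
  proof -
    have "(M has_derivative (*v) (cumulant_hess \<mu> l)) (at l)"
      unfolding M_def using l U(4) by (intro \<mu>.cumulant_hess_works) auto
    moreover have "(hmap g has_derivative (*v) (J (M l))) (at (M l))"
      using den[OF l] by (intro hmap_has_derivative) simp
    moreover have "(mean_inv \<nu> has_derivative (*v) (matrix_inv (cumulant_hess \<nu> (\<theta> l))))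
        (at (hmap g (M l)))"
      using \<nu>.mean_inv_has_derivative[OF \<theta>(1)[OF l]] unfolding \<theta>(2)[OF l] .
    ultimately have "((\<lambda>l. mean_inv \<nu> (hmap g (M l))) has_derivative D l) (at l)"
      unfolding D_def[abs_def] by (rule has_derivative_compose[OF has_derivative_compose])
    then show ?thesis
      unfolding \<theta>_def[abs_def] .
  qed
  \<comment> \<open>The Hessian for \<open>\<nu>\<close> is evaluated at \<open>D l v\<close> twice,
    by the definition of \<open>D\<close> and by the transformation rule. Cancelling the Jacobian
    and the Hessian for \<open>\<mu>\<close> leaves the claim.\<close>
  have D: "transpose A *v D l v - (D l v \<bullet> hmap g (M l)) *\<^sub>R c = v" if l: "l \<in> U" for l v
  proof -
    have \<mu>l: "l \<in> Theta \<mu>" and nz: "den g (M l) \<noteq> 0"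
      using l U(4) den[OF l] by auto
    let ?V = "cumulant_hess \<mu> l" and ?V1 = "cumulant_hess \<nu> (\<theta> l)"
    have "T_map g (variance_fun (nef \<nu>)) (M l) = ?V"
      using W(5)[OF U(5)[OF l]] variance_fun_nef[OF assms(1) \<mu>l] by (simp add: M_def)
    moreover have "variance_fun (nef \<nu>) (hmap g (M l)) = ?V1"
      using variance_fun_nef[OF assms(2) \<theta>(1)[OF l]] \<theta>(2)[OF l] by simp
    ultimately have "?V1 *v D l v = den g (M l) *\<^sub>R (J (M l) *v (?V *v (transpose (J (M l)) *v D l v)))"
      unfolding T_map_eq_iff[OF nz] by simp
    also have "?V1 *v D l v = J (M l) *v (?V *v v)"
      by (simp add: D_def matrix_vector_mul_assoc[of ?V1] matrix_mult_matrix_inv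
          \<nu>.invertible_cumulant_hess[OF \<theta>(1)[OF l]])
    also have "den g (M l) *\<^sub>R (J (M l) *v (?V *v (transpose (J (M l)) *v D l v))) =
        J (M l) *v (?V *v (transpose A *v D l v - (D l v \<bullet> hmap g (M l)) *\<^sub>R c))"
      unfolding den_transpose_jacobian[OF nz, symmetric] by (simp only: matrix_vector_mult_scaleR)
    finally show ?thesis
      by (metis invertible_mult_vec_inj invertible_jacobian_hmap[OF nz]
          \<mu>.invertible_cumulant_hess[OF \<mu>l])
  qed
  have \<nu>': "((\<lambda>l. cumulant \<nu> (\<theta> l)) has_derivative (\<lambda>v. D l v \<bullet> hmap g (M l))) (at l)" if l: "l \<in> U" for l
    using has_derivative_compose[OF \<theta>'[OF l] \<nu>.cumulant_has_derivative[OF \<theta>(1)[OF l]]]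
    by (simp add: \<theta>(2)[OF l])
  \<comment> \<open>The defect of the upper block; its derivative vanishes by \<open>D\<close>, and
    its constant value is \<open>l0\<close>.\<close>
  have "((\<lambda>l. l - (transpose A *v \<theta> l - cumulant \<nu> (\<theta> l) *\<^sub>R c)) has_derivative
      (\<lambda>v. v - (transpose A *v D l v - (D l v \<bullet> hmap g (M l)) *\<^sub>R c))) (at l)" if "l \<in> U" for l
    by (intro has_derivative_diff has_derivative_ident has_derivative_scaleR_left \<nu>' \<theta>' that
        bounded_linear.has_derivative[OF matrix_vector_mul_bounded_linear])
  then have "((\<lambda>l. l - (transpose A *v \<theta> l - cumulant \<nu> (\<theta> l) *\<^sub>R c)) has_derivative (\<lambda>v. 0)) (at l within U)"
    if "l \<in> U" for l
    using D that by (simp only: has_derivative_at_withinI diff_self)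
  then have "\<exists>l0. \<forall>l\<in>U. l - (transpose A *v \<theta> l - cumulant \<nu> (\<theta> l) *\<^sub>R c) = l0"
    by (rule has_derivative_zero_constant[OF U(2)])
  then obtain l0 where l0: "l = transpose A *v \<theta> l - cumulant \<nu> (\<theta> l) *\<^sub>R c + l0" if "l \<in> U" for l
    by (metis add.commute diff_add_cancel)
  \<comment> \<open>The defect of the lower block, with constant value \<open>k0\<close>; its
    derivative vanishes by \<open>tangent_equation\<close>.\<close>
  have k': "((\<lambda>l. cumulant \<mu> l + b \<bullet> \<theta> l - d * cumulant \<nu> (\<theta> l)) has_derivative
      (\<lambda>v. v \<bullet> M l + b \<bullet> D l v - d * (D l v \<bullet> hmap g (M l)))) (at l)" if "l \<in> U" for l
    unfolding M_def
    by (intro has_derivative_diff has_derivative_add has_derivative_inner_right has_derivative_mult_right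
        \<nu>'[unfolded M_def] \<theta>' that \<mu>.cumulant_has_derivative subsetD[OF U(4)])
  have zero: "v \<bullet> M l + b \<bullet> D l v - d * (D l v \<bullet> hmap g (M l)) = 0" if "l \<in> U" for l v
    using tangent_equation[of "M l" "D l v"] den[OF that] unfolding D[OF that] by simp
  have "((\<lambda>l. cumulant \<mu> l + b \<bullet> \<theta> l - d * cumulant \<nu> (\<theta> l)) has_derivative (\<lambda>v. 0)) (at l within U)"
    if "l \<in> U" for l
    using has_derivative_at_withinI[OF k'[OF that]] zero[OF that] by (simp only:)
  then have "\<exists>k0. \<forall>l\<in>U. cumulant \<mu> l + b \<bullet> \<theta> l - d * cumulant \<nu> (\<theta> l) = k0"
    by (rule has_derivative_zero_constant[OF U(2)])
  then obtain k0 where k0: "cumulant \<mu> l + b \<bullet> \<theta> l - d * cumulant \<nu> (\<theta> l) = k0" if "l \<in> U" for l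
    by blast
  have "- cumulant \<mu> l = b \<bullet> \<theta> l - d * cumulant \<nu> (\<theta> l) - k0" if "l \<in> U" for l
    using k0[OF that] by simp
  with l0 have "block_vec l (- cumulant \<mu> l) =
      block_mat (transpose A) c b d *v block_vec (\<theta> l) (- cumulant \<nu> (\<theta> l)) + block_vec l0 (- k0)"
    if "l \<in> U" for l
    unfolding block_equation_iff using that by blast
  with U \<theta>(1) show ?thesis
    by (intro exI[of _ U] exI[of _ \<theta>] exI[of _ l0] exI[of _ k0]) auto
qed

text \<open>The map \<open>\<theta>\<close> comes without any regularity. Inverting the transpose of
  \<open>g\<close> exhibits it as a linear function of \<open>(l - l0, k0 - k l)\<close>, so it
  inherits the differentiability of \<open>k\<close>.\<close>

lemma block_equation_differentiable:
  assumes "open U" "l \<in> U" "k differentiable at l"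
    and eq: "\<And>l. l \<in> U \<Longrightarrow> block_vec l (- k l) =
      block_mat (transpose A) c b d *v block_vec (\<theta> l) (s l) + block_vec l0 (- k0)"
  shows "\<theta> differentiable at l"
proof -
  define L where "L p = (\<chi> i. (matrix_inv (transpose g) *v block_vec (fst p) (snd p)) $ Inl i)"
    for p :: "(real ^ 'n) \<times> real"
  have "bounded_linear L"
    unfolding L_def[abs_def] linear_conv_bounded_linear[symmetric] by (rule linear_upper_block_solve)
  have L: "L (l - l0, k0 - k l) = \<theta> l" if "l \<in> U" for l
  proof -
    have "block_vec (l - l0) (k0 - k l) + block_vec l0 (- k0) = block_vec l (- k l)"
      by (simp add: block_vec_add)
    also have "\<dots> = transpose g *v block_vec (\<theta> l) (s l) + block_vec l0 (- k0)"
      unfolding eq[OF that] by (simp only: g_eq transpose_block_mat)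
    finally have "matrix_inv (transpose g) *v block_vec (l - l0) (k0 - k l) = block_vec (\<theta> l) (s l)"
      using invertible_g
      by (simp add: matrix_vector_mul_assoc matrix_inv_mult_matrix transpose_invertible
          del: transpose_matrix_vector)
    then show ?thesis
      by (simp add: L_def block_vec_def vec_eq_iff)
  qed
  obtain k' where "(k has_derivative k') (at l)"
    using assms(3) by (auto simp: differentiable_def)
  then have "((\<lambda>l. L (l - l0, k0 - k l)) has_derivative (\<lambda>v. L (v - 0, 0 - k' v))) (at l)"
    by (intro bounded_linear.has_derivative[OF \<open>bounded_linear L\<close>] has_derivative_Pair has_derivative_diff
        has_derivative_ident has_derivative_const)
  then have "(\<theta> has_derivative (\<lambda>v. L (v - 0, 0 - k' v))) (at l)"
    by (rule has_derivative_transform_within_open[OF _ assms(1,2)]) (rule L)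
  then show ?thesis
    by (rule differentiableI)
qed

lemma block_equation_imp_nef_eq_T:
  assumes "\<mu> \<in> nef_generators" "\<nu> \<in> nef_generators"
    and U: "open U" "U \<noteq> {}" "U \<subseteq> Theta \<mu>" and \<theta>: "\<theta> \<in> U \<rightarrow> Theta \<nu>"
    and eq: "\<And>l. l \<in> U \<Longrightarrow> block_vec l (- cumulant \<mu> l) =
      block_mat (transpose A) c b d *v block_vec (\<theta> l) (- cumulant \<nu> (\<theta> l)) + block_vec l0 (- k0)"
  shows "nef_eq_T (nef \<mu>) g (nef \<nu>)"
proof -
  interpret \<mu>: nef_generator \<mu> by unfold_locales fact
  interpret \<nu>: nef_generator \<nu> by unfold_locales fact
  define M where "M = cumulant_grad \<mu>"
  define N where "N l = cumulant_grad \<nu> (\<theta> l)" for l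
  have mem: "l \<in> Theta \<mu>" "\<theta> l \<in> Theta \<nu>" if "l \<in> U" for l
    using that U(3) \<theta> by auto
  have k': "(cumulant \<mu> has_derivative (\<lambda>h. h \<bullet> M l)) (at l)" if "l \<in> U" for l
    unfolding M_def by (rule \<mu>.cumulant_has_derivative[OF mem(1)[OF that]])
  define D where "D l = frechet_derivative \<theta> (at l)" for l
  have \<theta>': "(\<theta> has_derivative D l) (at l)" if "l \<in> U" for l
    unfolding D_def
    using block_equation_differentiable[OF U(1) that differentiableI[OF k'[OF that]] eq]
    by (simp add: frechet_derivative_works)
  have \<nu>': "((\<lambda>l. cumulant \<nu> (\<theta> l)) has_derivative (\<lambda>v. D l v \<bullet> N l)) (at l)" if "l \<in> U" for l
    unfolding N_def
    by (rule has_derivative_compose[OF \<theta>'[OF that] \<nu>.cumulant_has_derivative[OF mem(2)[OF that]]])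
  \<comment> \<open>The upper block equates an expression in \<open>\<theta>\<close> with the
    identity map on \<open>U\<close>; derivatives are unique.\<close>
  have D1: "transpose A *v D l v - (D l v \<bullet> N l) *\<^sub>R c = v" if l: "l \<in> U" for l v
  proof -
    have "((\<lambda>l. transpose A *v \<theta> l - cumulant \<nu> (\<theta> l) *\<^sub>R c + l0) has_derivative
        (\<lambda>v. transpose A *v D l v - (D l v \<bullet> N l) *\<^sub>R c)) (at l)"
      by (intro has_derivative_add_const has_derivative_diff has_derivative_scaleR_left \<nu>' \<theta>' l
          bounded_linear.has_derivative[OF matrix_vector_mul_bounded_linear])
    then have "((\<lambda>l. l) has_derivative (\<lambda>v. transpose A *v D l v - (D l v \<bullet> N l) *\<^sub>R c)) (at l)"
      by (rule has_derivative_transform_within_open[OF _ U(1) l])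
        (use eq in \<open>simp add: block_equation_iff\<close>)
    from has_derivative_unique[OF this has_derivative_ident] show ?thesis
      by meson
  qed
  have D2: "v \<bullet> M l = - (b \<bullet> D l v) + d * (D l v \<bullet> N l)" if l: "l \<in> U" for l v
  proof -
    have "((\<lambda>l. d * cumulant \<nu> (\<theta> l) + k0 - b \<bullet> \<theta> l) has_derivative
        (\<lambda>v. d * (D l v \<bullet> N l) - b \<bullet> D l v)) (at l)"
      by (intro has_derivative_diff has_derivative_add_const has_derivative_mult_right
          has_derivative_inner_right \<nu>' \<theta>' l)
    then have "(cumulant \<mu> has_derivative (\<lambda>v. d * (D l v \<bullet> N l) - b \<bullet> D l v)) (at l)"
      by (rule has_derivative_transform_within_open[OF _ U(1) l])
        (use eq in \<open>force simp: block_equation_iff\<close>)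
    from has_derivative_unique[OF k'[OF l] this] have "v \<bullet> M l = d * (D l v \<bullet> N l) - b \<bullet> D l v"
      by meson
    then show ?thesis
      by simp
  qed
  \<comment> \<open>By \<open>D1\<close> the vector \<open>v\<close> is recovered from
    \<open>D l v\<close>, so \<open>D l\<close> is injective and, in finite dimension, onto.
    Identities can then be tested on an arbitrary \<open>w = D l v\<close>.\<close>
  have surj_D: "surj (D l)" if l: "l \<in> U" for l
  proof (rule linear_inj_imp_surj)
    show "linear (D l)"
      using \<theta>'[OF l] by (rule has_derivative_linear)
    show "inj (D l)"
      by (rule injI) (metis D1[OF l])
  qed
  have N: "den g (M l) \<noteq> 0" "hmap g (M l) = N l" if l: "l \<in> U" for l
  proof -
    have "den g (M l) *\<^sub>R N l = A *v M l + b"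
    proof (rule vector_eq_ldot[THEN iffD1], rule allI)
      fix w
      obtain v where w: "w = D l v"
        using surj_D[OF l] by (metis surjD)
      \<comment> \<open>\<open>D2\<close> with \<open>v\<close> replaced by its expression from
        \<open>D1\<close>, which eliminates the differential of \<open>l\<close>.\<close>
      have "(transpose A *v w - (w \<bullet> N l) *\<^sub>R c) \<bullet> M l = - (b \<bullet> w) + d * (w \<bullet> N l)"
        unfolding w D1[OF l] by (rule D2[OF l])
      then show "w \<bullet> (den g (M l) *\<^sub>R N l) = w \<bullet> (A *v M l + b)"
        by (simp add: inner_diff_left inner_transpose_mult den_eq inner_add_right algebra_simps
            inner_commute[of b w] del: transpose_matrix_vector)
    qed
    from hmap_unique[OF this] show "den g (M l) \<noteq> 0" "hmap g (M l) = N l" .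
  qed
  \<comment> \<open>\<open>N\<close> is differentiated once as the gradient for \<open>\<nu>\<close>
    along \<open>\<theta>\<close> and once as \<open>hmap g\<close> after \<open>M\<close>;
    \<open>D1\<close> turns \<open>v\<close> into the scaled transposed Jacobian applied to
    \<open>w\<close>.\<close>
  have hess: "cumulant_hess \<nu> (\<theta> l) *v w =
      den g (M l) *\<^sub>R (J (M l) *v (cumulant_hess \<mu> l *v (transpose (J (M l)) *v w)))"
    if l: "l \<in> U" for l w
  proof -
    obtain v where w: "w = D l v"
      using surj_D[OF l] by (metis surjD)
    have "(N has_derivative (\<lambda>v. cumulant_hess \<nu> (\<theta> l) *v D l v)) (at l)"
      unfolding N_def
      by (rule has_derivative_compose[OF \<theta>'[OF l] \<nu>.cumulant_hess_works[OF mem(2)[OF l]]])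
    moreover have "((\<lambda>l. hmap g (M l)) has_derivative (\<lambda>v. J (M l) *v (cumulant_hess \<mu> l *v v))) (at l)"
      unfolding M_def
      by (rule has_derivative_compose[OF \<mu>.cumulant_hess_works[OF mem(1)[OF l]]])
        (rule hmap_has_derivative, use N(1)[OF l] in \<open>simp add: M_def\<close>)
    then have "(N has_derivative (\<lambda>v. J (M l) *v (cumulant_hess \<mu> l *v v))) (at l)"
      by (rule has_derivative_transform_within_open[OF _ U(1) l]) (rule N(2))
    ultimately have "(\<lambda>v. cumulant_hess \<nu> (\<theta> l) *v D l v) =
        (\<lambda>v. J (M l) *v (cumulant_hess \<mu> l *v v))"
      by (rule has_derivative_unique)
    then have "cumulant_hess \<nu> (\<theta> l) *v D l v = J (M l) *v (cumulant_hess \<mu> l *v v)"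
      by meson
    moreover have "den g (M l) *\<^sub>R (transpose (J (M l)) *v w) = v"
      unfolding den_transpose_jacobian[OF N(1)[OF l]] N(2)[OF l] w by (rule D1[OF l])
    ultimately show ?thesis
      unfolding w by (simp only: matrix_vector_mult_scaleR[symmetric])
  qed
  have den: "0 < den g (M l)" if l: "l \<in> U" for l
  proof -
    \<comment> \<open>The all-ones vector serves as a nonzero test vector: both quadratic forms
      related by \<open>hess\<close> are positive there, hence so is their ratio
      \<open>den g (M l)\<close>.\<close>
    let ?w = "transpose (J (M l)) *v (1 :: real ^ 'n)"
    have "?w \<noteq> 0"
      using invertible_mult_vec_inj[OF transpose_invertible[OF invertible_jacobian_hmap[OF N(1)[OF l]]], of 1 0]
      by (auto simp del: transpose_matrix_vector)
    have "0 < (1 :: real ^ 'n) \<bullet> (cumulant_hess \<nu> (\<theta> l) *v 1)"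
      by (rule \<nu>.cumulant_hess_pos[OF mem(2)[OF l]]) simp
    also have "\<dots> = den g (M l) * (?w \<bullet> (cumulant_hess \<mu> l *v ?w))"
      unfolding hess[OF l] by (simp only: inner_scaleR_right inner_transpose_mult)
    finally show ?thesis
      using \<mu>.cumulant_hess_pos[OF mem(1)[OF l] \<open>?w \<noteq> 0\<close>] by (simp add: zero_less_mult_iff)
  qed
  have "T_map g (variance_fun (nef \<nu>)) (M l) = variance_fun (nef \<mu>) (M l)" if l: "l \<in> U" for l
    unfolding T_map_eq_iff[OF N(1)[OF l]] N(2)[OF l] unfolding M_def N_def
      variance_fun_nef[OF assms(1) mem(1)[OF l]] variance_fun_nef[OF assms(2) mem(2)[OF l]]
    using hess[OF l] unfolding M_def by blast
  \<comment> \<open>The image of \<open>U\<close> under the gradient is the required set of means;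
    invariance of domain makes it open.\<close>
  moreover have "open (M ` U)"
    unfolding M_def by (rule \<mu>.open_image_cumulant_grad[OF U(1,3)])
  moreover have "M ` U \<subseteq> means_dom (nef \<mu>) \<inter> T_dom g (means_dom (nef \<nu>))"
    unfolding means_dom_nef[OF assms(1)] means_dom_nef[OF assms(2)]
    using mem den N(2) by (auto simp: T_dom_def M_def N_def)
  ultimately show ?thesis
    using U(2) unfolding nef_eq_T_def by (intro exI[of _ "M ` U"]) auto
qed

end

theorem theorem3p3:
  fixes \<mu> \<nu> :: "(real ^ 'n) measure"
    and F F1 :: "(real ^ 'n) measure set"
    and A :: "real ^ 'n ^ 'n" and b c :: "real ^ 'n" and d :: real
    and g :: "real ^ ('n::finite + 1) ^ ('n::finite + 1)"
  assumes "\<mu> \<in> nef_generators" and "\<nu> \<in> nef_generators"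
    and "F = nef \<mu>" and "F1 = nef \<nu>"
    and "g = block_mat A b c d" and "invertible g"
  shows "nef_eq_T F g F1 \<longleftrightarrow>
    (\<exists>U \<theta> l0 k0. open U \<and> U \<noteq> {} \<and> U \<subseteq> Theta \<mu> \<and> \<theta> \<in> U \<rightarrow> Theta \<nu> \<and>
       (\<forall>l\<in>U. block_vec l (- cumulant \<mu> l) =
          block_mat (transpose A) c b d *v block_vec (\<theta> l) (- cumulant \<nu> (\<theta> l))
            + block_vec l0 (- k0)))"
proof -
  interpret projective_map A b c d g
    using assms by unfold_locales
  show ?thesis
    unfolding assms(3,4)
    using nef_eq_T_imp_block_equation[OF assms(1,2)] block_equation_imp_nef_eq_T[OF assms(1,2)]
    by blast
qed

end
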